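(* Let $\mathcal{L}=\frac{1}{r(x)}\left[-\frac{d}{dx}\left(p(x)\frac{d}{dx}\right)+q(x)\right]$ on $(a,b)$ be a Sturm-Liouville operator satisfying the standing assumptions of the context, with the boundary conditions described there imposed on its domain so that it is self-adjoint. Let $w_1(x,\lambda),w_2(x,\lambda)$ be continuous functions on $(a,b)\times\mathbb{R}$ such that, for each fixed $\lambda\in\mathbb{R}$, $\{w_1(\cdot,\lambda),w_2(\cdot,\lambda)\}$ is a basis of the space of solutions of $\mathcal{L}u=\lambda u$, let $\rho=\{\rho_{ij}\}$ be the associated positive $2\times2$ matrix measure (see context), suppose that $e^{-t\lambda}\in L_2([0,\infty);\rho)$ for each $t>0$, and let $$\vartheta(t,x)=\int_{0-}^\infty e^{-t\lambda}\sum_{i,j=1}^2w_j(x,\lambda)\,d\rho_{ij}(\lambda),\qquad t>0,\ a<x<b,$$ be the generalized Yor integral for $\mathcal{L}$. Assume that the integrals $$\int_{0-}^\infty\lambda^ne^{-t\lambda}\sum_{i,j=1}^2w_j(x,\lambda)\,d\rho_{ij}(\lambda),\qquad n=0,1,2,\ldots$$ and $$\int_{0-}^\infty e^{-t\lambda}\sum_{i,j=1}^2\frac{\partial^nw_j(x,\lambda)}{\partial x^n}\,d\rho_{ij}(\lambda),\qquad n=0,1,2,\ldots$$ converge absolutely and uniformly for $t\ge t_0>0$ and $x$ in compact intervals of $(a,b)$. Then, for every $n\in\mathbb{N}$, the generalized Yor integral $\vartheta$ is a solution of the PDE $\frac{\partial^nu}{\partial t^n}=(-\mathcal{L}_x)^nu$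 on the domain $t>0$, $a<x<b$.
   Context: **Operator.** $-\infty\le a<b\le+\infty$; $p,r$ are real-valued, twice continuously differentiable functions on $(a,b)$; $q$ is a real-valued locally Hölder continuous function on $(a,b)$; $p(x),r(x)>0$ and $q(x)\ge0$ for $a<x<b$. $L_2(\Omega;w(x)dx)$ is the weighted $L_2$-space with norm $\left(\int_\Omega|f|^2w\,dx\right)^{1/2}$. The maximal domain is $\mathcal{D}(\mathcal{L})=\{u\in L_2((a,b);r\,dx):u,u'\in\mathrm{AC}_{\mathrm{loc}}(a,b),\ \mathcal{L}u\in L_2((a,b);r\,dx)\}$, where $\mathrm{AC}_{\mathrm{loc}}(a,b)$ is the space of functions on $(a,b)$ that can be written as the integral of a locally integrable function. The subscript in $\mathcal{L}_x$ indicates that $\mathcal{L}$ acts on the variable $x$. **Boundary classification.** For $a<x<y<b$ put $\mathcal{S}[x,y]=\int_x^y\frac{dt}{p(t)}$; fix $c\in(a,b)$ and let $I_a=\int_a^c\left(\lim_{x\searrow a}\mathcal{S}[x,y]\right)(r(y)+q(y))\,dy$, $I_b=\int_c^b\left(\lim_{y\nearrow b}\mathcal{S}[x,y]\right)(r(x)+q(x))\,dx$, $J_a=\int_a^c\mathcal{S}[x,c]\,(r(x)+q(x))\,dx$, $J_b=\int_c^b\mathcal{S}[c,y]\,(r(y)+q(y))\,dy$. The boundary $e\in\{a,b\}$ is *regular* if $I_e<\infty,J_e<\infty$; *exit* if $I_e<\infty,J_e=\infty$; *entrance* if $I_e=\infty,J_e<\infty$; *natural* if $I_e=J_e=\infty$.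 **Boundary conditions** imposed on $u\in\mathcal{D}(\mathcal{L})$ at $e$: if $e$ is regular, $(1-\alpha_e)\lim_{x\to e}u(x)+\epsilon_e\,\alpha_e\lim_{x\to e}p(x)u'(x)=0$ with an arbitrarily chosen $\alpha_e\in[0,1]$, where $\epsilon_a=-1$, $\epsilon_b=1$; if $e$ is exit, $\lim_{x\to e}u(x)=0$; if $e$ is entrance, or $e$ is natural with $\left|\int_e^cr(x)dx\right|<\infty$, $\lim_{x\to e}p(x)u'(x)=0$; if $e$ is natural with $\left|\int_e^cr(x)dx\right|=\infty$, no condition. With these conditions $\mathcal{L}$ is self-adjoint with spectrum contained in $[0,\infty)$. **Matrix measures.** A positive $2\times2$ matrix measure is a family $\rho=\{\rho_{ij}\}_{i,j=1,2}$ of complex-valued set functions on the bounded Borel subsets of $\mathbb{R}$ such that $\rho(B)$ is Hermitian positive semidefinite for every bounded Borel $B$, and $\rho_{ij}(\bigcup_kB_k)=\sum_k\rho_{ij}(B_k)$ for disjoint Borel sets $B_k$ with bounded union. It is *on the nonnegative real axis* if $\rho(I)=0$ for every interval $I\subseteq(-\infty,0)$. Then $L_2([0,\infty);\rho)$ is the completion of the bounded, piecewise continuous, compactly supported $\psi=(\psi_1,\psi_2)$ under $(\psi,\eta)=\int_{0-}^\infty\sum_{j,k}\psi_j\overline{\eta_k}\,d\rho_{jk}$. The notation $e^{-t\lambda}\in L_2([0,\infty);\rho)$ refers to the pair both of whose components equal $e^{-t\lambda}$. **Associated measure.** Given $w_1,w_2$ as in the claim, there is a positive $2\times2$ matrix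 measure $\rho$ on the nonnegative real axis such that $(\mathcal{F}f)_i(\lambda)=\int_a^bf(x)\overline{w_i(x,\lambda)}\,r(x)dx$ defines an isometric isomorphism of $L_2((a,b);r\,dx)$ onto $L_2([0,\infty);\rho)$ with inverse $(\mathcal{F}^{-1}\widetilde f)(x)=\int_{0-}^\infty\sum_{i,j=1}^2\widetilde f_i(\lambda)w_j(x,\lambda)\,d\rho_{ij}(\lambda)$ (integrals converging in the norms of the respective spaces). This is the measure $\rho$ of the claim, and the generalized Yor integral $\vartheta(t,\cdot)$ is $\mathcal{F}^{-1}$ applied to $e^{-t\lambda}$. The existence of the $x$-derivatives of $w_j$ appearing in the hypothesis is part of the hypothesis. *)

theory Defs
  imports "HOL-Analysis.Analysis"
begin

section \<open>The Sturm-Liouville operator\<close>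

definition twice_cont_diff_on :: "real set \<Rightarrow> (real \<Rightarrow> real) \<Rightarrow> bool" where
  "twice_cont_diff_on I f \<longleftrightarrow>
     (\<exists>f' f''. (\<forall>x\<in>I. (f has_real_derivative f' x) (at x)) \<and>
               (\<forall>x\<in>I. (f' has_real_derivative f'' x) (at x)) \<and> continuous_on I f'')"

definition locally_hoelder_on :: "real set \<Rightarrow> (real \<Rightarrow> real) \<Rightarrow> bool" where
  "locally_hoelder_on I f \<longleftrightarrow>
     (\<forall>x\<in>I. \<exists>\<delta>>0. \<exists>C\<ge>0. \<exists>\<gamma>\<in>{0<..1}. \<forall>y\<in>I \<inter> ball x \<delta>. \<forall>z\<in>I \<inter> ball x \<delta>.
        \<bar>f y - f z\<bar> \<le> C * \<bar>y - z\<bar> powr \<gamma>)"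

definition sl_coefficients ::
    "ereal \<Rightarrow> ereal \<Rightarrow> (real \<Rightarrow> real) \<Rightarrow> (real \<Rightarrow> real) \<Rightarrow> (real \<Rightarrow> real) \<Rightarrow> bool" where
  "sl_coefficients a b p q r \<longleftrightarrow>
     a < b \<and>
     twice_cont_diff_on (einterval a b) p \<and> twice_cont_diff_on (einterval a b) r \<and>
     locally_hoelder_on (einterval a b) q \<and>
     (\<forall>x\<in>einterval a b. p x > 0 \<and> r x > 0 \<and> q x \<ge> 0)"

definition vderiv :: "(real \<Rightarrow> complex) \<Rightarrow> real \<Rightarrow> complex" where
  "vderiv u x = vector_derivative u (at x)"

definition sl_op ::
    "(real \<Rightarrow> real) \<Rightarrow> (real \<Rightarrow> real) \<Rightarrow> (real \<Rightarrow> real) \<Rightarrow> (real \<Rightarrow> complex) \<Rightarrow> real \<Rightarrow> complex" where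
  "sl_op p q r u x =
     (1 / r x) *\<^sub>R (- vderiv (\<lambda>y. p y *\<^sub>R vderiv u y) x + q x *\<^sub>R u x)"

text \<open>All derivatives that occur in \<^term>\<open>sl_op p q r u\<close> exist at every point of \<open>I\<close>.\<close>

definition sl_differentiable_on :: "real set \<Rightarrow> (real \<Rightarrow> real) \<Rightarrow> (real \<Rightarrow> complex) \<Rightarrow> bool" where
  "sl_differentiable_on I p u \<longleftrightarrow>
     (\<forall>x\<in>I. u differentiable (at x) \<and> (\<lambda>y. p y *\<^sub>R vderiv u y) differentiable (at x))"

definition sl_solution ::
    "ereal \<Rightarrow> ereal \<Rightarrow> (real \<Rightarrow> real) \<Rightarrow> (real \<Rightarrow> real) \<Rightarrow> (real \<Rightarrow> real) \<Rightarrow> real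
     \<Rightarrow> (real \<Rightarrow> complex) \<Rightarrow> bool" where
  "sl_solution a b p q r l u \<longleftrightarrow>
     sl_differentiable_on (einterval a b) p u \<and>
     (\<forall>x\<in>einterval a b. sl_op p q r u x = of_real l * u x)"

text \<open>Functions on \<open>(a,b)\<close> are represented by total functions whose values outside the interval
  are irrelevant; hence all (in)dependence statements are relative to the interval.\<close>

definition sl_solution_basis ::
    "ereal \<Rightarrow> ereal \<Rightarrow> (real \<Rightarrow> real) \<Rightarrow> (real \<Rightarrow> real) \<Rightarrow> (real \<Rightarrow> real)
     \<Rightarrow> real \<Rightarrow> (real \<Rightarrow> complex) \<Rightarrow> (real \<Rightarrow> complex) \<Rightarrow> bool" where
  "sl_solution_basis a b p q r l u v \<longleftrightarrow>
     sl_solution a b p q r l u \<and> sl_solution a b p q r l v \<and>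
     (\<forall>c d. (\<forall>x\<in>einterval a b. c * u x + d * v x = 0) \<longrightarrow> c = 0 \<and> d = 0) \<and>
     (\<forall>f. sl_solution a b p q r l f \<longrightarrow>
        (\<exists>c d. \<forall>x\<in>einterval a b. f x = c * u x + d * v x))"

section \<open>The weighted space and the maximal domain\<close>

definition weighted_measure :: "ereal \<Rightarrow> ereal \<Rightarrow> (real \<Rightarrow> real) \<Rightarrow> real measure" where
  "weighted_measure a b r = density (lebesgue_on (einterval a b)) (\<lambda>x. ennreal (r x))"

definition L2_space :: "real measure \<Rightarrow> (real \<Rightarrow> complex) set" where
  "L2_space M = {f. f \<in> borel_measurable M \<and> integrable M (\<lambda>x. (cmod (f x))\<^sup>2)}"

definition L2_sqnorm :: "real measure \<Rightarrow> (real \<Rightarrow> complex) \<Rightarrow> ennreal" where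
  "L2_sqnorm M f = (\<integral>\<^sup>+x. ennreal ((cmod (f x))\<^sup>2) \<partial>M)"

definition L2_inner :: "real measure \<Rightarrow> (real \<Rightarrow> complex) \<Rightarrow> (real \<Rightarrow> complex) \<Rightarrow> complex" where
  "L2_inner M f g = (LINT x|M. f x * cnj (g x))"

definition AC_loc :: "real set \<Rightarrow> (real \<Rightarrow> complex) \<Rightarrow> bool" where
  "AC_loc I u \<longleftrightarrow>
     (\<exists>g. \<forall>s t. s \<le> t \<and> {s..t} \<subseteq> I \<longrightarrow>
        set_integrable lebesgue {s..t} g \<and> u t - u s = (LINT x:{s..t}|lebesgue. g x))"

definition sl_max_domain ::
    "ereal \<Rightarrow> ereal \<Rightarrow> (real \<Rightarrow> real) \<Rightarrow> (real \<Rightarrow> real) \<Rightarrow> (real \<Rightarrow> real) \<Rightarrow> (real \<Rightarrow> complex) set" where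
  "sl_max_domain a b p q r =
     {u \<in> L2_space (weighted_measure a b r).
        AC_loc (einterval a b) u \<and> AC_loc (einterval a b) (vderiv u) \<and>
        sl_op p q r u \<in> L2_space (weighted_measure a b r)}"

section \<open>Boundary classification and boundary conditions\<close>

definition scale_int :: "(real \<Rightarrow> real) \<Rightarrow> ereal \<Rightarrow> ereal \<Rightarrow> ennreal" where
  "scale_int p x y = (\<integral>\<^sup>+t\<in>einterval x y. ennreal (1 / p t) \<partial>lborel)"

definition bd_I_left :: "ereal \<Rightarrow> real \<Rightarrow> (real \<Rightarrow> real) \<Rightarrow> (real \<Rightarrow> real) \<Rightarrow> (real \<Rightarrow> real) \<Rightarrow> ennreal" where
  "bd_I_left a c p q r =
     (\<integral>\<^sup>+y\<in>einterval a (ereal c).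
        Lim (at_right a) (\<lambda>x. scale_int p x (ereal y)) * ennreal (r y + q y) \<partial>lborel)"

definition bd_I_right :: "ereal \<Rightarrow> real \<Rightarrow> (real \<Rightarrow> real) \<Rightarrow> (real \<Rightarrow> real) \<Rightarrow> (real \<Rightarrow> real) \<Rightarrow> ennreal" where
  "bd_I_right b c p q r =
     (\<integral>\<^sup>+x\<in>einterval (ereal c) b.
        Lim (at_left b) (\<lambda>y. scale_int p (ereal x) y) * ennreal (r x + q x) \<partial>lborel)"

definition bd_J_left :: "ereal \<Rightarrow> real \<Rightarrow> (real \<Rightarrow> real) \<Rightarrow> (real \<Rightarrow> real) \<Rightarrow> (real \<Rightarrow> real) \<Rightarrow> ennreal" where
  "bd_J_left a c p q r =
     (\<integral>\<^sup>+x\<in>einterval a (ereal c). scale_int p (ereal x) (ereal c) * ennreal (r x + q x) \<partial>lborel)"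

definition bd_J_right :: "ereal \<Rightarrow> real \<Rightarrow> (real \<Rightarrow> real) \<Rightarrow> (real \<Rightarrow> real) \<Rightarrow> (real \<Rightarrow> real) \<Rightarrow> ennreal" where
  "bd_J_right b c p q r =
     (\<integral>\<^sup>+y\<in>einterval (ereal c) b. scale_int p (ereal c) (ereal y) * ennreal (r y + q y) \<partial>lborel)"

text \<open>The filters \<open>x \<rightarrow> a\<close> and \<open>x \<rightarrow> b\<close> inside the interval, also for infinite endpoints.\<close>

definition to_left_end :: "ereal \<Rightarrow> real filter" where
  "to_left_end a = filtermap real_of_ereal (at_right a)"

definition to_right_end :: "ereal \<Rightarrow> real filter" where
  "to_right_end b = filtermap real_of_ereal (at_left b)"

text \<open>The condition at an endpoint approached along \<open>F\<close>, with \<open>Ie\<close>, \<open>Je\<close> the two classifying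
  integrals, \<open>Rm\<close> the mass of \<open>r\<close> near the endpoint and \<open>s\<close> the sign \<open>\<epsilon>\<^sub>e\<close>.\<close>

definition boundary_condition ::
    "real filter \<Rightarrow> ennreal \<Rightarrow> ennreal \<Rightarrow> ennreal \<Rightarrow> real \<Rightarrow> real
     \<Rightarrow> (real \<Rightarrow> real) \<Rightarrow> (real \<Rightarrow> complex) \<Rightarrow> bool" where
  "boundary_condition F Ie Je Rm s \<alpha> p u \<longleftrightarrow>
     (Ie < \<infinity> \<and> Je < \<infinity> \<longrightarrow>
        (\<exists>l m. (u \<longlongrightarrow> l) F \<and> ((\<lambda>x. p x *\<^sub>R vderiv u x) \<longlongrightarrow> m) F \<and>
               (1 - \<alpha>) *\<^sub>R l + (s * \<alpha>) *\<^sub>R m = 0)) \<and>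
     (Ie < \<infinity> \<and> Je = \<infinity> \<longrightarrow> (u \<longlongrightarrow> 0) F) \<and>
     (Ie = \<infinity> \<and> (Je < \<infinity> \<or> (Je = \<infinity> \<and> Rm < \<infinity>)) \<longrightarrow>
        ((\<lambda>x. p x *\<^sub>R vderiv u x) \<longlongrightarrow> 0) F)"

definition sl_domain ::
    "ereal \<Rightarrow> ereal \<Rightarrow> (real \<Rightarrow> real) \<Rightarrow> (real \<Rightarrow> real) \<Rightarrow> (real \<Rightarrow> real)
     \<Rightarrow> real \<Rightarrow> real \<Rightarrow> real \<Rightarrow> (real \<Rightarrow> complex) set" where
  "sl_domain a b p q r c \<alpha>\<^sub>a \<alpha>\<^sub>b =
     {u \<in> sl_max_domain a b p q r.
        boundary_condition (to_left_end a) (bd_I_left a c p q r) (bd_J_left a c p q r)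
          (\<integral>\<^sup>+x\<in>einterval a (ereal c). ennreal (r x) \<partial>lborel) (-1) \<alpha>\<^sub>a p u \<and>
        boundary_condition (to_right_end b) (bd_I_right b c p q r) (bd_J_right b c p q r)
          (\<integral>\<^sup>+x\<in>einterval (ereal c) b. ennreal (r x) \<partial>lborel) 1 \<alpha>\<^sub>b p u}"

text \<open>Density of the domain, symmetry, and inclusion of the domain of the adjoint in the domain;
  elements of the Hilbert space are functions up to null sets.\<close>

definition self_adjoint_on ::
    "real measure \<Rightarrow> (real \<Rightarrow> complex) set \<Rightarrow> ((real \<Rightarrow> complex) \<Rightarrow> real \<Rightarrow> complex) \<Rightarrow> bool" where
  "self_adjoint_on M D T \<longleftrightarrow>
     (\<forall>f\<in>L2_space M. \<forall>e>0. \<exists>u\<in>D. L2_sqnorm M (\<lambda>x. f x - u x) < e) \<and>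
     (\<forall>u\<in>D. \<forall>v\<in>D. L2_inner M (T u) v = L2_inner M u (T v)) \<and>
     (\<forall>g\<in>L2_space M. \<forall>h\<in>L2_space M.
        (\<forall>u\<in>D. L2_inner M (T u) g = L2_inner M u h) \<longrightarrow>
        (\<exists>v\<in>D. (AE x in M. v x = g x) \<and> (AE x in M. T v x = h x)))"

section \<open>Matrix measures\<close>

definition herm_psd :: "complex^2^2 \<Rightarrow> bool" where
  "herm_psd A \<longleftrightarrow>
     (\<forall>i j. A $ i $ j = cnj (A $ j $ i)) \<and>
     (\<forall>v::complex^2. 0 \<le> Re (\<Sum>i\<in>UNIV. \<Sum>j\<in>UNIV. cnj (v $ i) * A $ i $ j * v $ j))"

text \<open>Only the values on bounded Borel sets are meaningful.\<close>

definition matrix_measure :: "(real set \<Rightarrow> complex^2^2) \<Rightarrow> bool" where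
  "matrix_measure \<rho> \<longleftrightarrow>
     (\<forall>B\<in>sets borel. bounded B \<longrightarrow> herm_psd (\<rho> B)) \<and>
     (\<forall>B::nat \<Rightarrow> real set. range B \<subseteq> sets borel \<and> disjoint_family B \<and> bounded (\<Union>k. B k) \<longrightarrow>
        (\<forall>i j. (\<lambda>k. \<rho> (B k) $ i $ j) sums (\<rho> (\<Union>k. B k) $ i $ j)))"

definition on_nonneg_axis :: "(real set \<Rightarrow> complex^2^2) \<Rightarrow> bool" where
  "on_nonneg_axis \<rho> \<longleftrightarrow> (\<forall>J. is_interval J \<and> bounded J \<and> J \<subseteq> {..<0} \<longrightarrow> \<rho> J = 0)"

text \<open>Integration: all entries of a matrix measure have locally integrable densities with respect
  to the trace measure \<open>\<rho>\<^sub>1\<^sub>1 + \<rho>\<^sub>2\<^sub>2\<close>, and \<open>\<integral> \<Sum>\<^sub>i\<^sub>j f\<^sub>i\<^sub>j d\<rho>\<^sub>i\<^sub>j\<close> is the integral of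
  \<open>\<Sum>\<^sub>i\<^sub>j f\<^sub>i\<^sub>j m\<^sub>i\<^sub>j\<close> against it. The sum is under the integral sign because an element \<open>f\<close> of
  \<open>L\<^sub>2(\<rho>)\<close> need not have \<open>f\<^sub>i w\<^sub>j\<close> integrable for each \<open>\<rho>\<^sub>i\<^sub>j\<close> separately. When all
  \<open>f\<^sub>i\<^sub>j\<close> are integrable with respect to the corresponding \<open>\<rho>\<^sub>i\<^sub>j\<close>, it is the sum of the four
  integrals.\<close>

definition mm_trace :: "(real set \<Rightarrow> complex^2^2) \<Rightarrow> real measure" where
  "mm_trace \<rho> = measure_of UNIV (sets borel)
     (\<lambda>B. SUP n::nat. ennreal (Re (\<Sum>i\<in>UNIV. \<rho> (B \<inter> {- real n..real n}) $ i $ i)))"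

definition is_mm_density :: "(real set \<Rightarrow> complex^2^2) \<Rightarrow> (real \<Rightarrow> complex^2^2) \<Rightarrow> bool" where
  "is_mm_density \<rho> m \<longleftrightarrow>
     (\<forall>i j. (\<lambda>l. m l $ i $ j) \<in> borel_measurable borel \<and>
        (\<forall>B\<in>sets borel. bounded B \<longrightarrow>
           set_integrable (mm_trace \<rho>) B (\<lambda>l. m l $ i $ j) \<and>
           \<rho> B $ i $ j = (LINT l:B|mm_trace \<rho>. m l $ i $ j)))"

definition mm_density :: "(real set \<Rightarrow> complex^2^2) \<Rightarrow> real \<Rightarrow> complex^2^2" where
  "mm_density \<rho> = (SOME m. is_mm_density \<rho> m)"

definition mm_integrable ::
    "(real set \<Rightarrow> complex^2^2) \<Rightarrow> real set \<Rightarrow> (2 \<Rightarrow> 2 \<Rightarrow> real \<Rightarrow> complex) \<Rightarrow> bool" where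
  "mm_integrable \<rho> S f \<longleftrightarrow>
     set_integrable (mm_trace \<rho>) S (\<lambda>l. \<Sum>i\<in>UNIV. \<Sum>j\<in>UNIV. f i j l * mm_density \<rho> l $ i $ j)"

definition mm_integral ::
    "(real set \<Rightarrow> complex^2^2) \<Rightarrow> real set \<Rightarrow> (2 \<Rightarrow> 2 \<Rightarrow> real \<Rightarrow> complex) \<Rightarrow> complex" where
  "mm_integral \<rho> S f =
     (LINT l:S|mm_trace \<rho>. \<Sum>i\<in>UNIV. \<Sum>j\<in>UNIV. f i j l * mm_density \<rho> l $ i $ j)"

text \<open>The rest of this section proves that such a density exists, so that the choice above is
  never arbitrary. It is unique up to null sets, so integrals do not depend on it.\<close>

definition bdd_additive :: "(real set \<Rightarrow> real) \<Rightarrow> bool" where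
  "bdd_additive \<phi> \<longleftrightarrow> (\<forall>B\<in>sets borel. bounded B \<longrightarrow> 0 \<le> \<phi> B) \<and>
     (\<forall>B::nat \<Rightarrow> real set. range B \<subseteq> sets borel \<and> disjoint_family B \<and> bounded (\<Union>k. B k) \<longrightarrow>
        (\<lambda>k. \<phi> (B k)) sums \<phi> (\<Union>k. B k))"

definition bdd_measure :: "(real set \<Rightarrow> real) \<Rightarrow> real measure" where
  "bdd_measure \<phi> = measure_of UNIV (sets borel) (\<lambda>B. SUP n::nat. ennreal (\<phi> (B \<inter> {- real n..real n})))"

lemma bdd_additive_empty:
  assumes "bdd_additive \<phi>" shows "\<phi> {} = 0"
proof -
  have "(\<lambda>k::nat. \<phi> {}) sums \<phi> {}"
    using assms[unfolded bdd_additive_def, THEN conjunct2, rule_format, of "\<lambda>_. {}"]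
    by (simp add: disjoint_family_on_def)
  then have "(\<lambda>k::nat. \<phi> {}) \<longlonglongrightarrow> 0" by (rule summable_LIMSEQ_zero[OF sums_summable])
  then show ?thesis by (simp add: LIMSEQ_const_iff)
qed

lemma bdd_additive_Un:
  assumes "bdd_additive \<phi>" "A \<in> sets borel" "B \<in> sets borel" "bounded A" "bounded B" "A \<inter> B = {}"
  shows "\<phi> (A \<union> B) = \<phi> A + \<phi> B"
proof -
  have *: "(\<lambda>k. \<phi> (binaryset A B k)) sums \<phi> (\<Union>k. binaryset A B k)"
  proof (rule assms(1)[unfolded bdd_additive_def, THEN conjunct2, rule_format], intro conjI)
    show "range (binaryset A B) \<subseteq> sets borel" using assms by (auto simp: range_binaryset_eq)
    show "disjoint_family (binaryset A B)"
      using assms(6) by (auto simp: disjoint_family_on_def binaryset_def)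
    show "bounded (\<Union>k. binaryset A B k)" using assms by (simp add: UN_binaryset_eq)
  qed
  have "(\<lambda>k. \<phi> (binaryset A B k)) sums (\<phi> A + \<phi> B)"
    by (rule binaryset_sums) (rule bdd_additive_empty[OF assms(1)])
  with * show ?thesis by (simp add: UN_binaryset_eq sums_unique2)
qed

lemma bdd_additive_mono:
  assumes "bdd_additive \<phi>" "A \<in> sets borel" "B \<in> sets borel" "bounded B" "A \<subseteq> B"
  shows "\<phi> A \<le> \<phi> B"
proof -
  have "\<phi> B = \<phi> (A \<union> (B - A))" using assms(5) by (simp add: Un_absorb1)
  also have "\<dots> = \<phi> A + \<phi> (B - A)"
    using assms by (intro bdd_additive_Un) (auto intro: bounded_subset[OF assms(4)])
  finally show ?thesis
    using assms(1)[unfolded bdd_additive_def, THEN conjunct1, rule_format, of "B - A"] assms(2,3)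
      bounded_subset[OF assms(4), of "B - A"]
    by auto
qed

lemma sets_bdd_measure [simp, measurable_cong]: "sets (bdd_measure \<phi>) = sets borel"
  unfolding bdd_measure_def using sets.sets_measure_of_eq[of borel] by simp

lemma space_bdd_measure [simp]: "space (bdd_measure \<phi>) = UNIV"
  using sets_eq_imp_space_eq[OF sets_bdd_measure] by simp

lemma emeasure_bdd_measure:
  assumes \<phi>: "bdd_additive \<phi>" and B: "B \<in> sets borel"
  shows "emeasure (bdd_measure \<phi>) B = (SUP n::nat. ennreal (\<phi> (B \<inter> {- real n..real n})))"
proof (rule emeasure_measure_of[OF bdd_measure_def])
  let ?\<mu> = "\<lambda>B. SUP n::nat. ennreal (\<phi> (B \<inter> {- real n..real n}))"
  show "sets borel \<subseteq> Pow UNIV" by simp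
  show "B \<in> sets (bdd_measure \<phi>)" using B by simp
  show "positive (sets (bdd_measure \<phi>)) ?\<mu>"
    by (simp add: positive_def bdd_additive_empty[OF \<phi>])
  show "countably_additive (sets (bdd_measure \<phi>)) ?\<mu>"
  proof (rule countably_additiveI)
    fix A :: "nat \<Rightarrow> real set"
    assume A: "range A \<subseteq> sets (bdd_measure \<phi>)" "disjoint_family A"
    have nonneg: "0 \<le> \<phi> (C \<inter> {- real n..real n})" if "C \<in> sets borel" for C and n :: nat
      using that by (intro \<phi>[unfolded bdd_additive_def, THEN conjunct1, rule_format])
        (auto intro: bounded_subset[OF bounded_closed_interval])
    have "(\<Sum>k. ?\<mu> (A k)) = (SUP n::nat. \<Sum>k. ennreal (\<phi> (A k \<inter> {- real n..real n})))"
    proof (rule ennreal_suminf_SUP_eq)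
      fix k
      show "incseq (\<lambda>n::nat. ennreal (\<phi> (A k \<inter> {- real n..real n})))"
        using A(1) by (intro incseq_SucI ennreal_leI bdd_additive_mono[OF \<phi>]) auto
    qed
    also have "\<dots> = (SUP n::nat. ennreal (\<phi> ((\<Union>k. A k) \<inter> {- real n..real n})))"
    proof (rule SUP_cong[OF refl])
      fix n :: nat
      have "(\<lambda>k. \<phi> (A k \<inter> {- real n..real n})) sums \<phi> (\<Union>k. A k \<inter> {- real n..real n})"
        using A by (intro \<phi>[unfolded bdd_additive_def, THEN conjunct2, rule_format] conjI)
          (auto simp: disjoint_family_on_def intro: bounded_subset[OF bounded_closed_interval])
      then have "(\<lambda>k. ennreal (\<phi> (A k \<inter> {- real n..real n}))) sums ennreal (\<phi> (\<Union>k. A k \<inter> {- real n..real n}))"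
        using A by (subst sums_ennreal) (auto intro!: nonneg)
      then show "(\<Sum>k. ennreal (\<phi> (A k \<inter> {- real n..real n}))) = ennreal (\<phi> ((\<Union>k. A k) \<inter> {- real n..real n}))"
        by (simp add: sums_iff Int_UN_distrib2)
    qed
    finally show "(\<Sum>k. ?\<mu> (A k)) = ?\<mu> (\<Union>k. A k)" .
  qed
qed

lemma emeasure_bdd_measure_bounded:
  assumes \<phi>: "bdd_additive \<phi>" and B: "B \<in> sets borel" "bounded B"
  shows "emeasure (bdd_measure \<phi>) B = ennreal (\<phi> B)"
proof -
  obtain a where a: "\<And>x. x \<in> B \<Longrightarrow> \<bar>x\<bar> \<le> a" using B(2) by (auto simp: bounded_iff)
  obtain N :: nat where N: "a \<le> real N" using real_arch_simple by blast
  have "B \<subseteq> {- real N..real N}" using a N by force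
  then have "B \<inter> {- real N..real N} = B" by auto
  then have "ennreal (\<phi> B) \<le> (SUP n::nat. ennreal (\<phi> (B \<inter> {- real n..real n})))"
    by (metis (no_types, lifting) SUP_upper UNIV_I)
  moreover have "(SUP n::nat. ennreal (\<phi> (B \<inter> {- real n..real n}))) \<le> ennreal (\<phi> B)"
    using B by (intro SUP_least ennreal_leI bdd_additive_mono[OF \<phi>]) auto
  ultimately show ?thesis by (simp add: emeasure_bdd_measure[OF \<phi> B(1)])
qed

lemma sigma_finite_bdd_measure:
  assumes "bdd_additive \<phi>"
  shows "sigma_finite_measure (bdd_measure \<phi>)"
proof
  show "\<exists>A. countable A \<and> A \<subseteq> sets (bdd_measure \<phi>) \<and> \<Union> A = space (bdd_measure \<phi>) \<and>
          (\<forall>a\<in>A. emeasure (bdd_measure \<phi>) a \<noteq> \<infinity>)"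
  proof (intro exI[of _ "range (\<lambda>n::nat. {- real n..real n})"] conjI ballI)
    show "\<Union> (range (\<lambda>n::nat. {- real n..real n})) = space (bdd_measure \<phi>)"
    proof (intro equalityI subsetI)
      fix x assume "x \<in> space (bdd_measure \<phi>)"
      obtain N :: nat where "\<bar>x\<bar> \<le> real N" using real_arch_simple by blast
      then have "x \<in> {- real N..real N}" by auto
      then show "x \<in> \<Union> (range (\<lambda>n::nat. {- real n..real n}))" by blast
    qed simp
  qed (auto simp: emeasure_bdd_measure_bounded[OF assms])
qed

lemma bdd_additive_density:
  assumes \<phi>: "bdd_additive \<phi>" and \<tau>: "bdd_additive \<tau>"
    and le: "\<And>B. B \<in> sets borel \<Longrightarrow> bounded B \<Longrightarrow> \<phi> B \<le> 2 * \<tau> B"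
  obtains h :: "real \<Rightarrow> real" where "h \<in> borel_measurable borel"
    "\<And>B. B \<in> sets borel \<Longrightarrow> bounded B \<Longrightarrow> set_integrable (bdd_measure \<tau>) B h"
    "\<And>B. B \<in> sets borel \<Longrightarrow> bounded B \<Longrightarrow> (LINT l:B|bdd_measure \<tau>. h l) = \<phi> B"
proof -
  interpret T: sigma_finite_measure "bdd_measure \<tau>" by (rule sigma_finite_bdd_measure[OF \<tau>])
  have "absolutely_continuous (bdd_measure \<tau>) (bdd_measure \<phi>)"
    unfolding absolutely_continuous_def
  proof
    fix B assume "B \<in> null_sets (bdd_measure \<tau>)"
    then have B: "B \<in> sets borel" and 0: "emeasure (bdd_measure \<tau>) B = 0"
      by (auto simp: null_sets_def)
    have "ennreal (\<phi> (B \<inter> {- real n..real n})) = 0" for n :: nat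
    proof -
      have "ennreal (\<tau> (B \<inter> {- real n..real n})) = 0"
        using 0 by (simp add: emeasure_bdd_measure[OF \<tau> B] SUP_eq_iff bot_ennreal[symmetric] del: bot_ennreal)
      then have "\<tau> (B \<inter> {- real n..real n}) \<le> 0" by (simp add: ennreal_eq_0_iff)
      moreover have "\<phi> (B \<inter> {- real n..real n}) \<le> 2 * \<tau> (B \<inter> {- real n..real n})"
        using B by (intro le) (auto intro: bounded_subset[OF bounded_closed_interval])
      ultimately show ?thesis by (simp add: ennreal_eq_0_iff)
    qed
    then show "B \<in> null_sets (bdd_measure \<phi>)"
      using B by (simp add: null_sets_def emeasure_bdd_measure[OF \<phi> B])
  qed
  then obtain f where f: "f \<in> borel_measurable (bdd_measure \<tau>)" "density (bdd_measure \<tau>) f = bdd_measure \<phi>"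
    using T.Radon_Nikodym[of "bdd_measure \<phi>"] by auto
  have f_meas [measurable]: "f \<in> borel_measurable borel"
    using f(1) by (simp cong: measurable_cong_sets)
  have key: "has_bochner_integral (bdd_measure \<tau>) (\<lambda>x. indicator B x *\<^sub>R enn2real (f x)) (\<phi> B)"
    if B[measurable]: "B \<in> sets borel" and "bounded B" for B
  proof (rule has_bochner_integral_nn_integral)
    have int: "(\<integral>\<^sup>+x. f x * indicator B x \<partial>bdd_measure \<tau>) = ennreal (\<phi> B)"
      using emeasure_density[OF f(1), of B] f(2) that
      by (simp add: emeasure_bdd_measure_bounded[OF \<phi>])
    then have "AE x in bdd_measure \<tau>. f x * indicator B x \<noteq> \<infinity>"
      by (intro nn_integral_PInf_AE) auto
    then have "AE x in bdd_measure \<tau>. ennreal (indicator B x *\<^sub>R enn2real (f x)) = f x * indicator B x"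
      by eventually_elim (auto simp: indicator_def less_top)
    then show "(\<integral>\<^sup>+x. ennreal (indicator B x *\<^sub>R enn2real (f x)) \<partial>bdd_measure \<tau>) = ennreal (\<phi> B)"
      using int by (simp cong: nn_integral_cong_AE)
    show "0 \<le> \<phi> B" using \<phi> that by (auto simp: bdd_additive_def)
  qed auto
  show ?thesis
  proof (rule that[of "\<lambda>x. enn2real (f x)"])
    show "(\<lambda>x. enn2real (f x)) \<in> borel_measurable borel" by simp
  qed (use key in \<open>auto simp: set_integrable_def set_lebesgue_integral_def has_bochner_integral_iff\<close>)
qed

lemma mm_trace_eq: "mm_trace \<rho> = bdd_measure (\<lambda>B. Re (\<Sum>i\<in>UNIV. \<rho> B $ i $ i))"
  by (simp add: mm_trace_def bdd_measure_def)

theorem mm_density_exists: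
  assumes "matrix_measure \<rho>"
  shows "is_mm_density \<rho> (mm_density \<rho>)"
proof -
  have herm: "\<rho> B $ i $ j = cnj (\<rho> B $ j $ i)"
    and psd: "0 \<le> Re (\<Sum>i\<in>UNIV. \<Sum>j\<in>UNIV. cnj (v $ i) * \<rho> B $ i $ j * v $ j)"
    if "B \<in> sets borel" "bounded B" for B i j and v :: "complex^2"
    using assms that unfolding matrix_measure_def herm_psd_def by blast+
  have sums: "(\<lambda>k. \<rho> (B k) $ i $ j) sums (\<rho> (\<Union>k. B k) $ i $ j)"
    if "range B \<subseteq> sets borel" "disjoint_family B" "bounded (\<Union>k. B k)" for B :: "nat \<Rightarrow> real set" and i j
    using assms that unfolding matrix_measure_def by blast
  define Q where "Q v B = Re (\<Sum>i\<in>UNIV. \<Sum>j\<in>UNIV. cnj (v $ i) * \<rho> B $ i $ j * v $ j)"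
    for v :: "complex^2" and B
  define \<tau> where "\<tau> B = Re (\<Sum>i\<in>UNIV. \<rho> B $ i $ i)" for B
  have Q_add: "bdd_additive (Q v)" for v
    unfolding bdd_additive_def
  proof (intro conjI ballI allI impI)
    fix B :: "nat \<Rightarrow> real set"
    assume B: "range B \<subseteq> sets borel \<and> disjoint_family B \<and> bounded (\<Union>k. B k)"
    show "(\<lambda>k. Q v (B k)) sums Q v (\<Union>k. B k)"
      unfolding Q_def using B
      by (intro sums_Re sums_sum sums_mult sums_mult2 sums) auto
  qed (use psd in \<open>auto simp: Q_def\<close>)
  define e1 e2 e3 e4 :: "complex^2" where "e1 = vector [1, 0]" and "e2 = vector [0, 1]"
    and "e3 = vector [1, 1]" and "e4 = vector [1, \<i>]"
  define e5 e6 :: "complex^2" where "e5 = vector [1, -1]" and "e6 = vector [1, -\<i>]"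
  note e_defs = e1_def e2_def e3_def e4_def e5_def e6_def
  have Qs: "Q e1 B = Re (\<rho> B $ 1 $ 1)" "Q e2 B = Re (\<rho> B $ 2 $ 2)"
    "Q e3 B = \<tau> B + 2 * Re (\<rho> B $ 1 $ 2)" "Q e5 B = \<tau> B - 2 * Re (\<rho> B $ 1 $ 2)"
    "Q e4 B = \<tau> B - 2 * Im (\<rho> B $ 1 $ 2)" "Q e6 B = \<tau> B + 2 * Im (\<rho> B $ 1 $ 2)"
    "Im (\<rho> B $ 1 $ 1) = 0" "Im (\<rho> B $ 2 $ 2) = 0"
    if "B \<in> sets borel" "bounded B" for B
    using herm[OF that, of 2 1] herm[OF that, of 1 1] herm[OF that, of 2 2]
    by (auto simp: Q_def \<tau>_def e_defs sum_2 complex_eq_iff)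
  have \<tau>_eq: "\<tau> B = Q e1 B + Q e2 B" for B
    by (simp add: Q_def \<tau>_def e_defs sum_2)
  have \<tau>_add: "bdd_additive \<tau>"
    using Q_add[of e1] Q_add[of e2] unfolding bdd_additive_def \<tau>_eq
    by (auto intro!: sums_add add_nonneg_nonneg)
  have Q_nonneg: "0 \<le> Q v B" if "B \<in> sets borel" "bounded B" for v B
    using psd[OF that] by (simp add: Q_def)
  have le: "Q e1 B \<le> 2 * \<tau> B" "Q e2 B \<le> 2 * \<tau> B" "Q e3 B \<le> 2 * \<tau> B" "Q e4 B \<le> 2 * \<tau> B"
    if "B \<in> sets borel" "bounded B" for B
    using Q_nonneg[OF that, of e1] Q_nonneg[OF that, of e2] Q_nonneg[OF that, of e5]
      Q_nonneg[OF that, of e6] Qs[OF that] \<tau>_eq[of B] by linarith+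
  let ?T = "bdd_measure \<tau>"
  obtain h1 where h1: "h1 \<in> borel_measurable borel"
    "\<And>B. B \<in> sets borel \<Longrightarrow> bounded B \<Longrightarrow> set_integrable ?T B h1"
    "\<And>B. B \<in> sets borel \<Longrightarrow> bounded B \<Longrightarrow> (LINT l:B|?T. h1 l) = Q e1 B"
    using bdd_additive_density[OF Q_add[of e1] \<tau>_add le(1)] by blast
  obtain h2 where h2: "h2 \<in> borel_measurable borel"
    "\<And>B. B \<in> sets borel \<Longrightarrow> bounded B \<Longrightarrow> set_integrable ?T B h2"
    "\<And>B. B \<in> sets borel \<Longrightarrow> bounded B \<Longrightarrow> (LINT l:B|?T. h2 l) = Q e2 B"
    using bdd_additive_density[OF Q_add[of e2] \<tau>_add le(2)] by blast
  obtain h3 where h3: "h3 \<in> borel_measurable borel"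
    "\<And>B. B \<in> sets borel \<Longrightarrow> bounded B \<Longrightarrow> set_integrable ?T B h3"
    "\<And>B. B \<in> sets borel \<Longrightarrow> bounded B \<Longrightarrow> (LINT l:B|?T. h3 l) = Q e3 B"
    using bdd_additive_density[OF Q_add[of e3] \<tau>_add le(3)] by blast
  obtain h4 where h4: "h4 \<in> borel_measurable borel"
    "\<And>B. B \<in> sets borel \<Longrightarrow> bounded B \<Longrightarrow> set_integrable ?T B h4"
    "\<And>B. B \<in> sets borel \<Longrightarrow> bounded B \<Longrightarrow> (LINT l:B|?T. h4 l) = Q e4 B"
    using bdd_additive_density[OF Q_add[of e4] \<tau>_add le(4)] by blast
  define g3 where "g3 l = (h3 l - (h1 l + h2 l)) / 2" for l
  define g4 where "g4 l = ((h1 l + h2 l) - h4 l) / 2" for l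
  note [measurable] = h1(1) h2(1) h3(1) h4(1)
  have g_meas [measurable]: "g3 \<in> borel_measurable borel" "g4 \<in> borel_measurable borel"
    unfolding g3_def g4_def by measurable
  have g_int: "set_integrable ?T B g3" "set_integrable ?T B g4"
    and g_eq: "(LINT l:B|?T. g3 l) = Re (\<rho> B $ 1 $ 2)" "(LINT l:B|?T. g4 l) = Im (\<rho> B $ 1 $ 2)"
    if B: "B \<in> sets borel" "bounded B" for B
    unfolding g3_def g4_def
    using h1(2,3)[OF B] h2(2,3)[OF B] h3(2,3)[OF B] h4(2,3)[OF B] Qs[OF B] \<tau>_eq[of B]
    by (auto simp: set_integral_add set_integral_diff)
  define E :: "real \<Rightarrow> real \<Rightarrow> complex" where "E x y = of_real x + \<i> * of_real y" for x y
  have E_meas: "(\<lambda>l. E (f l) (g l)) \<in> borel_measurable borel"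
    if [measurable]: "f \<in> borel_measurable borel" "g \<in> borel_measurable borel" for f g
    unfolding E_def by measurable
  have E_int: "set_integrable ?T B (\<lambda>l. E (f l) (g l))"
    and E_eq: "(LINT l:B|?T. E (f l) (g l)) = E (LINT l:B|?T. f l) (LINT l:B|?T. g l)"
    if "set_integrable ?T B f" "set_integrable ?T B g" for f g B
  proof -
    have 1: "set_integrable ?T B (\<lambda>l. complex_of_real (f l))" "set_integrable ?T B (\<lambda>l. complex_of_real (g l))"
      using that unfolding set_integrable_def by (simp_all add: scaleR_conv_of_real flip: of_real_mult)
    have 2: "set_integrable ?T B (\<lambda>l. \<i> * complex_of_real (g l))"
      using 1(2) by simp
    show "set_integrable ?T B (\<lambda>l. E (f l) (g l))"
      unfolding E_def using 1(1) 2 by (rule set_integral_add)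
    show "(LINT l:B|?T. E (f l) (g l)) = E (LINT l:B|?T. f l) (LINT l:B|?T. g l)"
      unfolding E_def using 1(1) 2 by (simp add: set_integral_add set_integral_complex_of_real)
  qed
  define m :: "real \<Rightarrow> complex^2^2" where
    "m l = vector [vector [E (h1 l) 0, E (g3 l) (g4 l)], vector [E (g3 l) (- g4 l), E (h2 l) 0]]" for l
  have "is_mm_density \<rho> m"
    unfolding is_mm_density_def mm_trace_eq \<tau>_def[symmetric] forall_2
  proof (intro conjI ballI impI)
    fix B :: "real set" assume B: "B \<in> sets borel" "bounded B"
    have z: "set_integrable ?T B (\<lambda>_. 0::real)" by (simp add: set_integrable_def)
    have n: "set_integrable ?T B (\<lambda>l. - g4 l)" "(LINT l:B|?T. - g4 l) = - (LINT l:B|?T. g4 l)"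
      using g_int(2)[OF B] by (auto simp: set_integrable_def set_lebesgue_integral_def)
    note I = h1(2)[OF B] h2(2)[OF B] g_int[OF B] n z
    show "set_integrable ?T B (\<lambda>l. m l $ 1 $ 1)" "set_integrable ?T B (\<lambda>l. m l $ 1 $ 2)"
      "set_integrable ?T B (\<lambda>l. m l $ 2 $ 1)" "set_integrable ?T B (\<lambda>l. m l $ 2 $ 2)"
      by (auto simp: m_def intro!: E_int I)
    have m_entries: "m l $ 1 $ 1 = E (h1 l) 0" "m l $ 2 $ 2 = E (h2 l) 0"
      "m l $ 1 $ 2 = E (g3 l) (g4 l)" "m l $ 2 $ 1 = E (g3 l) (- g4 l)" for l
      by (simp_all add: m_def)
    have z0: "(LINT l:B|?T. 0::real) = 0" by (simp add: set_lebesgue_integral_def)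
    have E_iff: "c = E x y \<longleftrightarrow> Re c = x \<and> Im c = y" for c x y
      by (simp add: E_def complex_eq_iff)
    show "\<rho> B $ 1 $ 1 = (LINT l:B|?T. m l $ 1 $ 1)"
      unfolding m_entries E_eq[OF I(1) z] E_iff z0 using Qs[OF B] h1(3)[OF B] by linarith
    show "\<rho> B $ 2 $ 2 = (LINT l:B|?T. m l $ 2 $ 2)"
      unfolding m_entries E_eq[OF I(2) z] E_iff z0 using Qs[OF B] h2(3)[OF B] by linarith
    show "\<rho> B $ 1 $ 2 = (LINT l:B|?T. m l $ 1 $ 2)"
      unfolding m_entries E_eq[OF I(3,4)] E_iff using g_eq[OF B] by linarith
    show "\<rho> B $ 2 $ 1 = (LINT l:B|?T. m l $ 2 $ 1)"
      unfolding m_entries E_eq[OF I(3,5)] E_iff n(2) using g_eq[OF B] herm[OF B, of 2 1] by simp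
  qed (auto simp: m_def intro!: E_meas)
  then show ?thesis unfolding mm_density_def by (rule someI[where P = "is_mm_density \<rho>"])
qed

section \<open>The space \<open>L\<^sub>2([0,\<infinity>);\<rho>)\<close>\<close>

definition mm_sqnorm :: "(real set \<Rightarrow> complex^2^2) \<Rightarrow> (real \<Rightarrow> complex^2) \<Rightarrow> ennreal" where
  "mm_sqnorm \<rho> \<psi> =
     (\<integral>\<^sup>+l\<in>{0..}. ennreal (Re (\<Sum>j\<in>UNIV. \<Sum>k\<in>UNIV.
        \<psi> l $ j * cnj (\<psi> l $ k) * mm_density \<rho> l $ j $ k)) \<partial>mm_trace \<rho>)"

definition mm_basic :: "(real \<Rightarrow> complex^2) set" where
  "mm_basic =
     {\<psi>. bounded (\<psi> ` {0..}) \<and>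
          (\<exists>S. finite S \<and> continuous_on ({0..} - S) \<psi>) \<and>
          (\<exists>N. \<forall>l>N. \<psi> l = 0)}"

text \<open>The completion, realised inside the measurable functions (modulo functions of norm \<open>0\<close>)
  as the set of limits of sequences in \<^const>\<open>mm_basic\<close>.\<close>

definition mm_L2 :: "(real set \<Rightarrow> complex^2^2) \<Rightarrow> (real \<Rightarrow> complex^2) set" where
  "mm_L2 \<rho> =
     {\<psi>. \<psi> \<in> borel_measurable (restrict_space borel {0..}) \<and>
          (\<exists>\<phi>. (\<forall>n::nat. \<phi> n \<in> mm_basic) \<and>
               (\<lambda>n. mm_sqnorm \<rho> (\<lambda>l. \<phi> n l - \<psi> l)) \<longlonglongrightarrow> 0)}"

section \<open>The associated matrix measure\<close>

text \<open>\<open>is_transform \<dots> f g\<close> and \<open>is_inv_transform \<dots> g f\<close> say that the integrals defining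
  \<open>\<F> f\<close> and \<open>\<F>\<^sup>-\<^sup>1 g\<close> converge in norm, to \<open>g\<close> and \<open>f\<close> respectively.\<close>

definition is_transform ::
    "ereal \<Rightarrow> ereal \<Rightarrow> (real \<Rightarrow> real) \<Rightarrow> (2 \<Rightarrow> real \<Rightarrow> real \<Rightarrow> complex) \<Rightarrow> (real set \<Rightarrow> complex^2^2)
     \<Rightarrow> (real \<Rightarrow> complex) \<Rightarrow> (real \<Rightarrow> complex^2) \<Rightarrow> bool" where
  "is_transform a b r w \<rho> f g \<longleftrightarrow>
     ((\<lambda>(s, t). mm_sqnorm \<rho> (\<lambda>l.
          (\<chi> i. LINT x:{s..t}|lebesgue. f x * cnj (w i x l) * of_real (r x)) - g l))
        \<longlongrightarrow> 0) (to_left_end a \<times>\<^sub>F to_right_end b)"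

definition is_inv_transform ::
    "ereal \<Rightarrow> ereal \<Rightarrow> (real \<Rightarrow> real) \<Rightarrow> (2 \<Rightarrow> real \<Rightarrow> real \<Rightarrow> complex) \<Rightarrow> (real set \<Rightarrow> complex^2^2)
     \<Rightarrow> (real \<Rightarrow> complex^2) \<Rightarrow> (real \<Rightarrow> complex) \<Rightarrow> bool" where
  "is_inv_transform a b r w \<rho> g f \<longleftrightarrow>
     ((\<lambda>N. L2_sqnorm (weighted_measure a b r) (\<lambda>x.
          mm_integral \<rho> {0..N} (\<lambda>i j l. g l $ i * w j x l) - f x)) \<longlongrightarrow> 0) at_top"

definition associated_matrix_measure ::
    "ereal \<Rightarrow> ereal \<Rightarrow> (real \<Rightarrow> real) \<Rightarrow> (2 \<Rightarrow> real \<Rightarrow> real \<Rightarrow> complex) \<Rightarrow> (real set \<Rightarrow> complex^2^2)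
     \<Rightarrow> bool" where
  "associated_matrix_measure a b r w \<rho> \<longleftrightarrow>
     matrix_measure \<rho> \<and> on_nonneg_axis \<rho> \<and>
     (\<forall>f\<in>L2_space (weighted_measure a b r). \<exists>g\<in>mm_L2 \<rho>. is_transform a b r w \<rho> f g) \<and>
     (\<forall>g\<in>mm_L2 \<rho>. \<exists>f\<in>L2_space (weighted_measure a b r). is_transform a b r w \<rho> f g) \<and>
     (\<forall>f\<in>L2_space (weighted_measure a b r). \<forall>g\<in>mm_L2 \<rho>.
        is_transform a b r w \<rho> f g \<longrightarrow> mm_sqnorm \<rho> g = L2_sqnorm (weighted_measure a b r) f) \<and>
     (\<forall>f\<in>L2_space (weighted_measure a b r). \<forall>g\<in>mm_L2 \<rho>.
        is_transform a b r w \<rho> f g \<longleftrightarrow> is_inv_transform a b r w \<rho> g f)"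

section \<open>The generalized Yor integral\<close>

definition yor_integral ::
    "(real set \<Rightarrow> complex^2^2) \<Rightarrow> (2 \<Rightarrow> real \<Rightarrow> real \<Rightarrow> complex) \<Rightarrow> real \<Rightarrow> real \<Rightarrow> complex" where
  "yor_integral \<rho> w t x = mm_integral \<rho> {0..} (\<lambda>i j l. of_real (exp (- t * l)) * w j x l)"

text \<open>Absolute convergence, and uniform convergence (of the integrals themselves, not necessarily
  of the integrals of the absolute values) for \<open>t \<ge> t\<^sub>0 > 0\<close> and \<open>x\<close> in compact subintervals.\<close>

definition converges_abs_unif ::
    "ereal \<Rightarrow> ereal \<Rightarrow> (real set \<Rightarrow> complex^2^2)
     \<Rightarrow> (real \<Rightarrow> real \<Rightarrow> 2 \<Rightarrow> 2 \<Rightarrow> real \<Rightarrow> complex) \<Rightarrow> bool" where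
  "converges_abs_unif a b \<rho> f \<longleftrightarrow>
     (\<forall>t\<^sub>0>0. \<forall>c d. {c..d} \<subseteq> einterval a b \<longrightarrow>
        (\<forall>t\<ge>t\<^sub>0. \<forall>x\<in>{c..d}. mm_integrable \<rho> {0..} (f t x)) \<and>
        uniform_limit ({t\<^sub>0..} \<times> {c..d})
          (\<lambda>N (t, x). mm_integral \<rho> {0..N} (f t x))
          (\<lambda>(t, x). mm_integral \<rho> {0..} (f t x)) at_top)"

text \<open>\<open>u\<close> solves \<open>\<partial>\<^sup>n u / \<partial>t\<^sup>n = (-\<L>\<^sub>x)\<^sup>n u\<close> classically for \<open>t > 0\<close>, \<open>a < x < b\<close>: all derivatives
  in the iterated derivative and in the iterated operator exist. The coefficients are not assumed
  smooth, so \<open>(-\<L>\<^sub>x)\<^sup>n\<close> has to be read as an iteration.\<close>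

definition solves_sl_pde ::
    "ereal \<Rightarrow> ereal \<Rightarrow> (real \<Rightarrow> real) \<Rightarrow> (real \<Rightarrow> real) \<Rightarrow> (real \<Rightarrow> real) \<Rightarrow> nat
     \<Rightarrow> (real \<Rightarrow> real \<Rightarrow> complex) \<Rightarrow> bool" where
  "solves_sl_pde a b p q r n u \<longleftrightarrow>
     (\<forall>t>0. \<forall>x\<in>einterval a b. \<forall>k<n. ((vderiv ^^ k) (\<lambda>s. u s x)) differentiable (at t)) \<and>
     (\<forall>t>0. \<forall>k<n. sl_differentiable_on (einterval a b) p (((\<lambda>v y. - sl_op p q r v y) ^^ k) (u t))) \<and>
     (\<forall>t>0. \<forall>x\<in>einterval a b.
        (vderiv ^^ n) (\<lambda>s. u s x) t = ((\<lambda>v y. - sl_op p q r v y) ^^ n) (u t) x)"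

end

(*
  Put W(x,l) = sum_ij w_j(x,l) m_ij(l), where m is the density of rho with respect to its trace
  measure mu, so that theta(t,x) is the integral of exp(-tl) W(x,l) dmu(l), and W(.,l) solves Lu = lu.
  With s the scale function, Lu = f on [c,d] is equivalent to
    u(x) = A + s(x) B + int_c^x (s(x) - s(z)) (q(z) u(z) - r(z) f(z)) dz,
  where A and B are determined by u(c), u(d) and the integral. In this form the equation is linear
  and free of derivatives: by Fubini it passes to the integrals over 0 <= l <= N, and by uniform
  convergence to the limit N -> infinity. Hence Psi_k(t,x) = int (-l)^k exp(-tl) W(x,l) dmu(l)
  satisfies -L_x Psi_k = Psi_{k+1}, while dominated convergence in t gives
  d/dt Psi_k = Psi_{k+1}; the theorem follows by iterating both identities from theta = Psi_0.
*)
theory Submission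
  imports Defs
begin

section \<open>The Sturm-Liouville equation as a Volterra integral equation\<close>

lemma einterval_Icc_nbhd:
  assumes "x \<in> einterval a b"
  obtains c d where "c < x" "x < d" "{c..d} \<subseteq> einterval a b"
proof -
  obtain e where "e > 0" "cball x e \<subseteq> einterval a b"
    using open_einterval assms by (metis open_contains_cball)
  then show ?thesis using that[of "x - e" "x + e"] by (auto simp: cball_eq_atLeastAtMost)
qed

lemma locally_hoelder_on_imp_continuous_on:
  assumes "locally_hoelder_on I q"
  shows "continuous_on I q"
  unfolding continuous_on_def
proof
  fix x assume x: "x \<in> I"
  obtain \<delta> C \<gamma> where *: "\<delta> > 0" "C \<ge> 0" "\<gamma> \<in> {0<..1::real}"
    "\<And>y z. y \<in> I \<inter> ball x \<delta> \<Longrightarrow> z \<in> I \<inter> ball x \<delta> \<Longrightarrow> \<bar>q y - q z\<bar> \<le> C * \<bar>y - z\<bar> powr \<gamma>"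
    using assms x unfolding locally_hoelder_on_def by meson
  \<comment> \<open>A power with positive exponent is continuous at base 0, so the Hoelder bound
    tends to \<open>C * 0 powr \<gamma>\<close>, which is 0.\<close>
  have "((\<lambda>y. C * \<bar>y - x\<bar> powr \<gamma>) \<longlongrightarrow> C * 0 powr \<gamma>) (at x within I)"
    using *(3) by (intro tendsto_intros tendsto_powr') (auto intro!: tendsto_eq_intros)
  then have "((\<lambda>y. C * \<bar>y - x\<bar> powr \<gamma>) \<longlongrightarrow> 0) (at x within I)" by simp
  moreover have "\<forall>\<^sub>F y in at x within I. norm (q y - q x) \<le> C * \<bar>y - x\<bar> powr \<gamma>"
    unfolding eventually_at using *(1,4) x by (auto simp: dist_commute intro!: exI[of _ \<delta>])
  ultimately have "((\<lambda>y. q y - q x) \<longlongrightarrow> 0) (at x within I)"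
    by (rule Lim_null_comparison[rotated])
  then show "(q \<longlongrightarrow> q x) (at x within I)" by (rule LIM_zero_cancel)
qed

lemma twice_cont_diff_on_imp_continuous_on:
  assumes "twice_cont_diff_on I f" shows "continuous_on I f"
  using assms unfolding twice_cont_diff_on_def
  by (meson DERIV_isCont continuous_at_imp_continuous_on)

lemma sl_coefficients_continuous:
  assumes "sl_coefficients a b p q r"
  shows "continuous_on (einterval a b) p" "continuous_on (einterval a b) q"
    "continuous_on (einterval a b) r"
  using assms locally_hoelder_on_imp_continuous_on twice_cont_diff_on_imp_continuous_on
  unfolding sl_coefficients_def by blast+

text \<open>Both functions admit the same vector derivatives D at x, so the choice inside
  \<open>vector_derivative\<close> returns the same value, even at points where no derivative
  exists.\<close>

lemma vderiv_cong_open: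
  assumes "open I" "x \<in> I" "\<And>y. y \<in> I \<Longrightarrow> u y = v y"
  shows "vderiv u x = vderiv v x"
proof -
  have "(u has_vector_derivative D) (at x) = (v has_vector_derivative D) (at x)" for D
    using has_vector_derivative_transform_within_open[OF _ assms(1,2), of u D v]
      has_vector_derivative_transform_within_open[OF _ assms(1,2), of v D u] assms(3) by auto
  then show ?thesis by (simp add: vderiv_def vector_derivative_def)
qed

lemma differentiable_cong_open:
  fixes u v :: "real \<Rightarrow> complex"
  assumes "open I" "x \<in> I" "\<And>y. y \<in> I \<Longrightarrow> u y = v y" "u differentiable (at x)"
  shows "v differentiable (at x)"
proof -
  obtain D where "(u has_derivative D) (at x)" using assms(4) by (auto simp: differentiable_def)
  then have "(v has_derivative D) (at x)"
    by (rule has_derivative_transform_within_open[OF _ assms(1-3)])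
  then show ?thesis by (auto simp: differentiable_def)
qed

text \<open>The operator is local. This is needed for its iterates, which are known in closed form
  only on the interval while being total functions.\<close>

lemma sl_cong_open:
  assumes "open I" "\<And>y. y \<in> I \<Longrightarrow> u y = v y"
  shows sl_op_cong_open: "x \<in> I \<Longrightarrow> sl_op p q r u x = sl_op p q r v x"
    and sl_differentiable_on_cong_open:
      "sl_differentiable_on I p u \<Longrightarrow> sl_differentiable_on I p v"
proof -
  have 1: "vderiv u y = vderiv v y" if "y \<in> I" for y
    using assms that by (intro vderiv_cong_open) auto
  then show "x \<in> I \<Longrightarrow> sl_op p q r u x = sl_op p q r v x"
    using vderiv_cong_open[OF assms(1), of x "\<lambda>y. p y *\<^sub>R vderiv u y" "\<lambda>y. p y *\<^sub>R vderiv v y"] assms(2)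
    by (simp add: sl_op_def)
  assume "sl_differentiable_on I p u"
  then show "sl_differentiable_on I p v" unfolding sl_differentiable_on_def
    using differentiable_cong_open[OF assms(1), of _ u v]
      differentiable_cong_open[OF assms(1), of _ "\<lambda>y. p y *\<^sub>R vderiv u y" "\<lambda>y. p y *\<^sub>R vderiv v y"]
      assms(2) 1 by simp
qed

lemma differentiable_imp_has_vderiv:
  "u differentiable (at x) \<Longrightarrow> (u has_vector_derivative vderiv u x) (at x)"
  by (simp add: vderiv_def vector_derivative_works)

lemma vderiv_at: "(u has_vector_derivative D) (at x) \<Longrightarrow> vderiv u x = D"
  by (simp add: vderiv_def vector_derivative_at)

lemma vderiv_linear:
  assumes "u differentiable (at x)" "v differentiable (at x)"
  shows "vderiv (\<lambda>y. \<alpha> * u y + \<beta> * v y) x = \<alpha> * vderiv u x + \<beta> * vderiv v x"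
  by (intro vderiv_at derivative_eq_intros refl has_vector_derivative_add
      has_vector_derivative_mult_right differentiable_imp_has_vderiv assms)

text \<open>Applied for each fixed l to the two basis solutions, with coefficients that come from
  the density of the matrix measure.\<close>

lemma sl_solution_linear:
  assumes "sl_solution a b p q r l u" "sl_solution a b p q r l v"
  shows "sl_solution a b p q r l (\<lambda>x. \<alpha> * u x + \<beta> * v x)"
proof -
  let ?I = "einterval a b" and ?f = "\<lambda>x. \<alpha> * u x + \<beta> * v x"
  let ?pu = "\<lambda>y. p y *\<^sub>R vderiv u y" and ?pv = "\<lambda>y. p y *\<^sub>R vderiv v y"
  have d: "u differentiable (at x)" "v differentiable (at x)"
    "?pu differentiable (at x)" "?pv differentiable (at x)"
    and e: "sl_op p q r u x = of_real l * u x" "sl_op p q r v x = of_real l * v x" if "x \<in> ?I" for x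
    using assms that by (auto simp: sl_solution_def sl_differentiable_on_def)
  have 1: "\<alpha> * ?pu x + \<beta> * ?pv x = p x *\<^sub>R vderiv ?f x" if "x \<in> ?I" for x
    using vderiv_linear[OF d(1,2)[OF that]] by (simp add: scaleR_conv_of_real algebra_simps)
  have 2: "vderiv (\<lambda>y. p y *\<^sub>R vderiv ?f y) x = \<alpha> * vderiv ?pu x + \<beta> * vderiv ?pv x" if "x \<in> ?I" for x
    unfolding vderiv_linear[OF d(3,4)[OF that], symmetric]
    by (rule vderiv_cong_open[OF open_einterval that]) (rule 1[symmetric])
  \<comment> \<open>On the interval \<open>p f'\<close> is the combination of \<open>p u'\<close>
    and \<open>p v'\<close> given by 1; differentiability transfers along this equality on an open
    set.\<close>
  have 3: "(\<lambda>y. p y *\<^sub>R vderiv ?f y) differentiable (at x)" if "x \<in> ?I" for x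
    by (rule differentiable_cong_open[OF open_einterval that 1], assumption)
      (intro differentiable_add differentiable_mult differentiable_const d that)
  have "sl_op p q r ?f x = \<alpha> * sl_op p q r u x + \<beta> * sl_op p q r v x" if "x \<in> ?I" for x
    unfolding sl_op_def 2[OF that] by (simp add: scaleR_conv_of_real algebra_simps)
  then show ?thesis using d 3 e by (auto simp: sl_solution_def sl_differentiable_on_def algebra_simps)
qed

section \<open>The scale function and the equivalence with the Volterra form\<close>

definition scale_fun :: "(real \<Rightarrow> real) \<Rightarrow> real \<Rightarrow> real \<Rightarrow> real" where
  "scale_fun p c x = integral {c..x} (\<lambda>z. 1 / p z)"

text \<open>Variation of constants: for continuous h this is the solution of
  \<open>(p u')' = h\<close> for which u and \<open>p u'\<close> vanish at c.\<close>

definition sl_volterra :: "(real \<Rightarrow> real) \<Rightarrow> real \<Rightarrow> (real \<Rightarrow> complex) \<Rightarrow> real \<Rightarrow> complex" where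
  "sl_volterra p c h x = integral {c..x} (\<lambda>z. (scale_fun p c x - scale_fun p c z) *\<^sub>R h z)"

context
  fixes p :: "real \<Rightarrow> real" and c d :: real
  assumes p_cont: "continuous_on {c..d} p" and p_pos: "\<And>x. x \<in> {c..d} \<Longrightarrow> p x > 0" and cd: "c < d"
begin

lemma p_inverse_cont: "continuous_on {c..d} (\<lambda>z. 1 / p z)"
  using p_pos by (intro continuous_intros p_cont) force

lemma scale_fun_deriv: "x \<in> {c..d} \<Longrightarrow> (scale_fun p c has_real_derivative 1 / p x) (at x within {c..d})"
  unfolding scale_fun_def by (intro integral_has_real_derivative p_inverse_cont)

lemma scale_fun_cont: "continuous_on {c..d} (scale_fun p c)"
  by (meson DERIV_continuous continuous_on_eq_continuous_within scale_fun_deriv)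

lemma scale_fun_refl: "scale_fun p c c = 0"
  by (simp add: scale_fun_def)

text \<open>By the mean value theorem the value is \<open>d - c\<close> times some
  \<open>1 / p z\<close>. Positivity permits division by it when the slope at c is recovered from
  the values at c and d.\<close>

lemma scale_fun_pos: "scale_fun p c d > 0"
proof -
  have D: "(scale_fun p c has_real_derivative 1 / p x) (at x)" if "c < x" "x < d" for x
    using scale_fun_deriv[of x] at_within_Icc_at[of c x d] that by simp
  then obtain l z where z: "c < z" "z < d" "DERIV (scale_fun p c) z :> l"
    "scale_fun p c d - scale_fun p c c = (d - c) * l"
    using MVT[OF cd scale_fun_cont] real_differentiable_def by blast
  then have "l = 1 / p z" using D[of z] DERIV_unique by blast
  then show ?thesis using z p_pos[of z] cd by (simp add: scale_fun_refl)
qed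

text \<open>Integration by parts for the first-order system \<open>u' = v / p\<close>,
  \<open>v' = h\<close>.\<close>

lemma sl_volterra_of_derivs:
  assumes u: "\<And>x. x \<in> {c..d} \<Longrightarrow> (u has_vector_derivative (1 / p x) *\<^sub>R v x) (at x)"
    and v: "\<And>x. x \<in> {c..d} \<Longrightarrow> (v has_vector_derivative h x) (at x)"
    and x: "x \<in> {c..d}"
  shows "u x = u c + scale_fun p c x *\<^sub>R v c + sl_volterra p c h x"
proof -
  \<comment> \<open>An antiderivative in z of the Volterra integrand: since
    \<open>s' = 1 / p\<close> and \<open>u' = v / p\<close>, the two terms in v cancel. At z = x it
    equals u x, and at z = c it equals \<open>u c + s x * v c\<close>.\<close>
  let ?G = "\<lambda>z. (scale_fun p c x - scale_fun p c z) *\<^sub>R v z + u z"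
  have "((\<lambda>z. (scale_fun p c x - scale_fun p c z) *\<^sub>R h z) has_integral (?G x - ?G c)) {c..x}"
  proof (rule fundamental_theorem_of_calculus)
    fix z assume "z \<in> {c..x}"
    then have z: "z \<in> {c..d}" and sub: "{c..x} \<subseteq> {c..d}" using x by auto
    have s: "(scale_fun p c has_real_derivative 1 / p z) (at z within {c..x})"
      using scale_fun_deriv[OF z] sub by (rule DERIV_subset)
    have "(?G has_vector_derivative ((scale_fun p c x - scale_fun p c z) *\<^sub>R h z + (0 - 1 / p z) *\<^sub>R v z)
        + (1 / p z) *\<^sub>R v z) (at z within {c..x})"
      by (intro has_vector_derivative_add has_vector_derivative_scaleR DERIV_diff DERIV_const s
          has_vector_derivative_at_within[OF v[OF z]] has_vector_derivative_at_within[OF u[OF z]])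
    then show "(?G has_vector_derivative (scale_fun p c x - scale_fun p c z) *\<^sub>R h z) (at z within {c..x})"
      by simp
  qed (use x in auto)
  then have "sl_volterra p c h x = ?G x - ?G c"
    unfolding sl_volterra_def by (rule integral_unique)
  then show ?thesis by (simp add: scale_fun_refl)
qed

text \<open>The converse direction: a function given by the Volterra formula regains its
  derivatives, and the quantity playing the part of \<open>p u'\<close> is B plus the integral of
  h.\<close>

lemma sl_volterra_deriv:
  assumes h: "continuous_on {c..d} h"
    and u: "\<And>x. x \<in> {c..d} \<Longrightarrow> u x = A + scale_fun p c x *\<^sub>R B + sl_volterra p c h x"
    and x: "x \<in> {c<..<d}"
  shows "(u has_vector_derivative (1 / p x) *\<^sub>R (B + integral {c..x} h)) (at x)"
    and "((\<lambda>y. B + integral {c..y} h) has_vector_derivative h x) (at x)"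
proof -
  have D: "((\<lambda>y. integral {c..y} g) has_vector_derivative g x) (at x)"
    if "continuous_on {c..d} g" for g :: "real \<Rightarrow> complex"
    using integral_has_vector_derivative[OF that, of x] x by (simp add: at_within_Icc_at)
  have s: "(scale_fun p c has_real_derivative 1 / p x) (at x)"
    using scale_fun_deriv[of x] at_within_Icc_at[of c x d] x by simp
  have sh: "continuous_on {c..d} (\<lambda>z. scale_fun p c z *\<^sub>R h z)"
    by (intro continuous_intros scale_fun_cont h)
  \<comment> \<open>The kernel is split so that the variable occurs only in front of the integrals
    and as their upper limit. In the derivative the two terms \<open>s x * h x\<close> then
    cancel.\<close>
  let ?v = "\<lambda>y. A + scale_fun p c y *\<^sub>R B + scale_fun p c y *\<^sub>R integral {c..y} h
    - integral {c..y} (\<lambda>z. scale_fun p c z *\<^sub>R h z)"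
  have "?v y = u y" if y: "y \<in> {c<..<d}" for y
  proof -
    have "continuous_on {c..y} h" "continuous_on {c..y} (\<lambda>z. scale_fun p c z *\<^sub>R h z)"
      using y by (auto intro: continuous_on_subset[OF h] continuous_on_subset[OF sh])
    then have "sl_volterra p c h y = scale_fun p c y *\<^sub>R integral {c..y} h
        - integral {c..y} (\<lambda>z. scale_fun p c z *\<^sub>R h z)"
      unfolding sl_volterra_def scaleR_diff_left
      by (subst integral_diff) (auto intro!: integrable_continuous_real continuous_intros)
    then show ?thesis using u[of y] y by simp
  qed
  moreover have "(?v has_vector_derivative (0 + (scale_fun p c x *\<^sub>R 0 + (1 / p x) *\<^sub>R B)
      + (scale_fun p c x *\<^sub>R h x + (1 / p x) *\<^sub>R integral {c..x} h) - scale_fun p c x *\<^sub>R h x)) (at x)"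
    by (intro has_vector_derivative_add has_vector_derivative_diff has_vector_derivative_scaleR
        has_vector_derivative_const s D h sh)
  ultimately show "(u has_vector_derivative (1 / p x) *\<^sub>R (B + integral {c..x} h)) (at x)"
    using has_vector_derivative_transform_within_open[of ?v _ x "{c<..<d}" u] x
    by (simp add: scaleR_add_right)
  show "((\<lambda>y. B + integral {c..y} h) has_vector_derivative h x) (at x)"
    using has_vector_derivative_add[OF has_vector_derivative_const D[OF h]] by simp
qed

end

section \<open>Fubini, dominated convergence and differentiation under the integral sign\<close>

section \<open>Integrals depending on a parameter\<close>

text \<open>Fubini applies because the majorant depends on l alone and \<open>{c..d}\<close> has
  finite length, so their product is integrable on the product space.\<close>

lemma set_integral_swap_Icc:
  fixes f :: "real \<Rightarrow> real \<Rightarrow> complex"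
  assumes "sigma_finite_measure \<mu>" and sets_\<mu>: "sets \<mu> = sets borel"
    and S: "S \<in> sets borel" and g: "set_integrable \<mu> S g"
    and meas: "(\<lambda>(z, l). indicator {c..d} z *\<^sub>R f z l) \<in> borel_measurable borel"
    and bound: "\<And>z l. z \<in> {c..d} \<Longrightarrow> l \<in> S \<Longrightarrow> norm (f z l) \<le> g l"
  shows "set_integrable \<mu> S (\<lambda>l. LINT z:{c..d}|lborel. f z l)"
    and "(LINT l:S|\<mu>. LINT z:{c..d}|lborel. f z l) = (LINT z:{c..d}|lborel. LINT l:S|\<mu>. f z l)"
proof -
  interpret sigma_finite_measure \<mu> by fact
  interpret P: pair_sigma_finite lborel \<mu> ..
  note [measurable] = S
  note [measurable_cong] = sets_\<mu>
  \<comment> \<open>\<open>G\<close> is the product majorant and \<open>F\<close> the integrand cut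
    off to the rectangle.\<close>
  define G where "G z l = indicator {c..d} z * (indicator S l * g l)" for z l :: real
  define F where "F z l = indicator S l *\<^sub>R indicator {c..d} z *\<^sub>R f z l" for z l :: real
  have sets_pair: "sets (lborel \<Otimes>\<^sub>M \<mu>) = sets (borel :: (real \<times> real) measure)"
    unfolding borel_prod[symmetric] by (rule sets_pair_measure_cong) (simp_all add: sets_\<mu>)
  have g_int: "integrable \<mu> (\<lambda>l. indicator S l * g l)" using g by (simp add: set_integrable_def)
  have [measurable]: "(\<lambda>l. indicator S l * g l) \<in> borel_measurable \<mu>" using g_int by simp
  have ind: "integrable lborel (indicat_real {c..d})"
    by (rule integrable_real_indicator) (auto simp: emeasure_lborel_Icc_eq)
  have "integrable (lborel \<Otimes>\<^sub>M \<mu>) (\<lambda>(z, l). G z l)"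
  proof (rule P.Fubini_integrable)
    show "(\<lambda>(z, l). G z l) \<in> borel_measurable (lborel \<Otimes>\<^sub>M \<mu>)" unfolding G_def by measurable
    show "integrable lborel (\<lambda>x. LINT y|\<mu>. norm (case (x, y) of (z, l) \<Rightarrow> G z l))"
      unfolding G_def using ind by (simp add: abs_mult)
    show "AE x in lborel. integrable \<mu> (\<lambda>y. case (x, y) of (z, l) \<Rightarrow> G z l)"
      unfolding G_def using g_int by simp
  qed
  then have F_int: "integrable (lborel \<Otimes>\<^sub>M \<mu>) (\<lambda>(z, l). F z l)"
  proof (rule Bochner_Integration.integrable_bound)
    have [measurable]: "(\<lambda>(z, l). indicator {c..d} z *\<^sub>R f z l) \<in> borel_measurable (lborel \<Otimes>\<^sub>M \<mu>)"
      using meas measurable_cong_sets[OF sets_pair refl] by blast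
    have "(\<lambda>x. indicator S (snd x) *\<^sub>R (\<lambda>(z, l). indicator {c..d} z *\<^sub>R f z l) x) \<in> borel_measurable (lborel \<Otimes>\<^sub>M \<mu>)"
      by measurable
    then show "(\<lambda>(z, l). F z l) \<in> borel_measurable (lborel \<Otimes>\<^sub>M \<mu>)"
      unfolding F_def by (simp add: case_prod_beta')
    have "norm (F z l) \<le> norm (G z l)" for z l
      unfolding F_def G_def using bound[of z l] by (auto simp: indicator_def)
    then show "AE x in lborel \<Otimes>\<^sub>M \<mu>. norm (case x of (z, l) \<Rightarrow> F z l) \<le> norm (case x of (z, l) \<Rightarrow> G z l)"
      by (auto simp: case_prod_beta)
  qed
  \<comment> \<open>With the indicators in either order, each inner integral sees the outer
    indicator as a constant factor.\<close>
  have F': "F z l = indicator {c..d} z *\<^sub>R indicator S l *\<^sub>R f z l" for z l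
    by (simp add: F_def)
  have 1: "(LINT z|lborel. F z l) = indicator S l *\<^sub>R (LINT z:{c..d}|lborel. f z l)" for l
    unfolding F_def set_lebesgue_integral_def by (rule integral_scaleR_right)
  have 2: "(LINT l|\<mu>. F z l) = indicator {c..d} z *\<^sub>R (LINT l:S|\<mu>. f z l)" for z
    unfolding F' set_lebesgue_integral_def by (rule integral_scaleR_right)
  show "set_integrable \<mu> S (\<lambda>l. LINT z:{c..d}|lborel. f z l)"
    using P.integrable_snd[OF F_int] unfolding 1 by (simp add: set_integrable_def)
  show "(LINT l:S|\<mu>. LINT z:{c..d}|lborel. f z l) = (LINT z:{c..d}|lborel. LINT l:S|\<mu>. f z l)"
    using P.Fubini_integral[OF F_int] unfolding 1 2 by (simp only: set_lebesgue_integral_def)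
qed

text \<open>Sequential continuity by dominated convergence; the majorant g is the same for all x in
  K.\<close>

lemma continuous_on_set_integral:
  fixes V :: "real \<Rightarrow> real \<Rightarrow> complex"
  assumes cont: "\<And>l. l \<in> S \<Longrightarrow> continuous_on K (\<lambda>x. V x l)"
    and meas: "\<And>x. x \<in> K \<Longrightarrow> (\<lambda>l. indicator S l *\<^sub>R V x l) \<in> borel_measurable \<mu>"
    and g: "set_integrable \<mu> S g"
    and bound: "\<And>x l. x \<in> K \<Longrightarrow> l \<in> S \<Longrightarrow> norm (V x l) \<le> g l"
  shows "continuous_on K (\<lambda>x. LINT l:S|\<mu>. V x l)"
  unfolding continuous_on_sequentially comp_def set_lebesgue_integral_def
proof (intro allI ballI impI, elim conjE)
  fix y :: "nat \<Rightarrow> real" and x assume x: "x \<in> K" "\<forall>n. y n \<in> K" "y \<longlonglongrightarrow> x"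
  show "(\<lambda>n. LINT l|\<mu>. indicator S l *\<^sub>R V (y n) l) \<longlonglongrightarrow> (LINT l|\<mu>. indicator S l *\<^sub>R V x l)"
  proof (rule integral_dominated_convergence)
    show "integrable \<mu> (\<lambda>l. indicator S l * g l)" using g by (simp add: set_integrable_def)
    have "(\<lambda>n. indicator S l *\<^sub>R V (y n) l) \<longlonglongrightarrow> indicator S l *\<^sub>R V x l" for l
      using cont[of l] x unfolding continuous_on_sequentially comp_def
      by (cases "l \<in> S") auto
    then show "AE l in \<mu>. (\<lambda>n. indicator S l *\<^sub>R V (y n) l) \<longlonglongrightarrow> indicator S l *\<^sub>R V x l" by simp
    have "norm (indicator S l *\<^sub>R V (y n) l) \<le> indicator S l * g l" for l n
      using bound[of "y n" l] x(2) by (cases "l \<in> S") auto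
    then show "AE l in \<mu>. norm (indicator S l *\<^sub>R V (y n) l) \<le> indicator S l * g l" for n by simp
  qed (use meas x in auto)
qed

text \<open>Follows from \<open>1 - exp (- h) \<le> h\<close>. The factor
  \<open>l * exp (- m * l)\<close>, with m below both s and t, will dominate all difference
  quotients in t at once.\<close>

lemma exp_diff_bound:
  fixes l s t m :: real
  assumes "0 \<le> l" "m \<le> s" "m \<le> t"
  shows "\<bar>exp (- s * l) - exp (- t * l)\<bar> \<le> \<bar>s - t\<bar> * (l * exp (- m * l))"
proof -
  have *: "\<bar>exp (- s * l) - exp (- t * l)\<bar> \<le> \<bar>s - t\<bar> * (l * exp (- m * l))"
    if "m \<le> s" "s \<le> t" for s t
  proof -
    have "exp (- s * l) - exp (- t * l) = exp (- s * l) * (1 - exp (- ((t - s) * l)))"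
      by (simp add: right_diff_distrib flip: exp_add) (simp add: algebra_simps)
    also have "\<dots> \<le> exp (- m * l) * ((t - s) * l)"
      using exp_ge_add_one_self[of "- ((t - s) * l)"] that assms(1)
      by (intro mult_mono) (auto intro: mult_right_mono)
    also have "\<dots> = \<bar>s - t\<bar> * (l * exp (- m * l))" using that by simp
    finally show ?thesis using that assms(1) by (subst abs_of_nonneg) (auto intro: mult_right_mono)
  qed
  show ?thesis
    using *[of s t] *[of t s] assms by (cases s t rule: linorder_cases) (auto simp: abs_minus_commute)
qed

text \<open>Dominated convergence for the difference quotients, with a majorant that is integrable
  by \<open>int1\<close> at \<open>t / 2\<close>.\<close>

lemma laplace_has_vector_derivative:
  fixes F :: "real \<Rightarrow> complex"
  assumes t: "0 < t"
    and int0: "\<And>s. 0 < s \<Longrightarrow> set_integrable \<mu> {0..} (\<lambda>l. exp (- s * l) *\<^sub>R F l)"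
    and int1: "\<And>s. 0 < s \<Longrightarrow> set_integrable \<mu> {0..} (\<lambda>l. (l * exp (- s * l)) *\<^sub>R F l)"
  shows "((\<lambda>s. LINT l:{0..}|\<mu>. exp (- s * l) *\<^sub>R F l) has_vector_derivative
      - (LINT l:{0..}|\<mu>. (l * exp (- t * l)) *\<^sub>R F l)) (at t)"
proof -
  let ?g = "\<lambda>s. LINT l:{0..}|\<mu>. exp (- s * l) *\<^sub>R F l"
  let ?D = "- (LINT l:{0..}|\<mu>. (l * exp (- t * l)) *\<^sub>R F l)"
  \<comment> \<open>An open neighbourhood of t bounded away from 0, on which \<open>t / 2\<close>
    serves as the common exponent.\<close>
  let ?S = "{t / 2<..}"
  \<comment> \<open>The remainder of the first-order expansion of \<open>exp (- y * l)\<close> at y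
    = t, divided by the distance to t. Its integral against F is the remainder quotient of the whole
    integral.\<close>
  define e where "e y l = (1 / \<bar>y - t\<bar>) * (exp (- y * l) - (exp (- t * l) + (y - t) * (- l * exp (- t * l))))" for y l
  have eq: "(1 / norm (y - t)) *\<^sub>R (?g y - (?g t + (y - t) *\<^sub>R ?D)) = (LINT l:{0..}|\<mu>. e y l *\<^sub>R F l)"
    and int: "set_integrable \<mu> {0..} (\<lambda>l. e y l *\<^sub>R F l)"
    if "y \<in> ?S" for y
  proof -
    have y: "0 < y" using that t by auto
    define E G where "E s l = exp (- s * l) *\<^sub>R F l" and "G l = (l * exp (- t * l)) *\<^sub>R F l" for s l
    have e_eq: "e y l *\<^sub>R F l = (1 / norm (y - t)) *\<^sub>R (E y l - (E t l - (y - t) *\<^sub>R G l))" for l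
      by (simp add: e_def E_def G_def scaleR_conv_of_real algebra_simps)
    have I: "set_integrable \<mu> {0..} (E y)" "set_integrable \<mu> {0..} (E t)" "set_integrable \<mu> {0..} G"
      unfolding E_def G_def by (intro int0 int1 y t)+
    have I3: "set_integrable \<mu> {0..} (\<lambda>l. (y - t) *\<^sub>R G l)"
      using I(3) by (rule set_integrable_scaleR_right)
    have I2: "set_integrable \<mu> {0..} (\<lambda>l. E t l - (y - t) *\<^sub>R G l)"
      by (rule set_integral_diff(1)[OF I(2) I3])
    have I1: "set_integrable \<mu> {0..} (\<lambda>l. E y l - (E t l - (y - t) *\<^sub>R G l))"
      by (rule set_integral_diff(1)[OF I(1) I2])
    then show "set_integrable \<mu> {0..} (\<lambda>l. e y l *\<^sub>R F l)"
      unfolding e_eq by (rule set_integrable_scaleR_right)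
    have "(LINT l:{0..}|\<mu>. E y l - (E t l - (y - t) *\<^sub>R G l))
        = (LINT l:{0..}|\<mu>. E y l) - ((LINT l:{0..}|\<mu>. E t l) - (y - t) *\<^sub>R (LINT l:{0..}|\<mu>. G l))"
      unfolding set_integral_diff(2)[OF I(1) I2] set_integral_diff(2)[OF I(2) I3] set_integral_scaleR_right ..
    then show "(1 / norm (y - t)) *\<^sub>R (?g y - (?g t + (y - t) *\<^sub>R ?D)) = (LINT l:{0..}|\<mu>. e y l *\<^sub>R F l)"
      unfolding e_eq set_integral_scaleR_right by (simp add: E_def G_def)
  qed
  have "((\<lambda>y. (1 / norm (y - t)) *\<^sub>R (?g y - (?g t + (y - t) *\<^sub>R ?D))) \<longlongrightarrow> 0) (at t within ?S)"
    unfolding tendsto_at_iff_sequentially comp_def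
  proof (intro allI impI)
    fix X :: "nat \<Rightarrow> real" assume X: "\<forall>i. X i \<in> ?S - {t}" "X \<longlonglongrightarrow> t"
    have "(\<lambda>n. LINT l|\<mu>. indicator {0..} l *\<^sub>R (e (X n) l *\<^sub>R F l)) \<longlonglongrightarrow> (LINT l|\<mu>. 0)"
    proof (rule integral_dominated_convergence)
      show "integrable \<mu> (\<lambda>l. 2 * norm (indicator {0..} l *\<^sub>R ((l * exp (- (t / 2) * l)) *\<^sub>R F l)))"
        using int1[of "t / 2"] t unfolding set_integrable_def by (intro integrable_mult_right integrable_norm) auto
      show "(\<lambda>l. indicator {0..} l *\<^sub>R (e (X n) l *\<^sub>R F l)) \<in> borel_measurable \<mu>" for n
        using int[of "X n"] X(1) unfolding set_integrable_def by (intro borel_measurable_integrable) auto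
      have "(\<lambda>n. e (X n) l) \<longlonglongrightarrow> 0" for l
      \<comment> \<open>Pointwise convergence is the differentiability of the exponential at
        t.\<close>
      proof -
        have "((\<lambda>s. exp (- s * l)) has_real_derivative - l * exp (- t * l)) (at t within ?S)"
          by (auto intro!: derivative_eq_intros)
        then have "((\<lambda>y. e y l) \<longlongrightarrow> 0) (at t within ?S)"
          unfolding e_def has_field_derivative_def has_derivative_within by (simp add: mult_ac)
        then show ?thesis using X unfolding tendsto_at_iff_sequentially comp_def by blast
      qed
      then have "(\<lambda>n. indicator {0..} l *\<^sub>R (e (X n) l *\<^sub>R F l)) \<longlonglongrightarrow> indicator {0..} l *\<^sub>R (0 *\<^sub>R F l)" for l
        by (intro tendsto_intros)
      then show "AE l in \<mu>. (\<lambda>n. indicator {0..} l *\<^sub>R (e (X n) l *\<^sub>R F l)) \<longlonglongrightarrow> 0" by simp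
      \<comment> \<open>The factor 2 counts the difference of exponentials and the linear term, each
        at most \<open>\<bar>X n - t\<bar> * (l * exp (- (t / 2) * l))\<close>.\<close>
      have "norm (indicator {0..} l *\<^sub>R (e (X n) l *\<^sub>R F l))
          \<le> 2 * norm (indicator {0..} l *\<^sub>R ((l * exp (- (t / 2) * l)) *\<^sub>R F l))" for n l
      proof (cases "l \<in> {0..}")
        case True
        have Xn: "t / 2 \<le> X n" "X n \<noteq> t" using X(1) by (auto intro: less_imp_le)
        have 1: "\<bar>exp (- X n * l) - exp (- t * l)\<bar> \<le> \<bar>X n - t\<bar> * (l * exp (- (t / 2) * l))"
          using True Xn t by (intro exp_diff_bound) auto
        have "\<bar>(X n - t) * (l * exp (- t * l))\<bar> \<le> \<bar>X n - t\<bar> * (l * exp (- (t / 2) * l))"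
          using True t by (auto simp: abs_mult intro!: mult_mono)
        with 1 have "\<bar>exp (- X n * l) - (exp (- t * l) + (X n - t) * (- l * exp (- t * l)))\<bar>
            \<le> \<bar>X n - t\<bar> * (2 * (l * exp (- (t / 2) * l)))" by simp
        then have "\<bar>e (X n) l\<bar> \<le> 2 * (l * exp (- (t / 2) * l))"
          using Xn unfolding e_def abs_mult by (simp add: field_simps)
        then have "\<bar>e (X n) l\<bar> * norm (F l) \<le> (2 * (l * exp (- (t / 2) * l))) * norm (F l)"
          by (rule mult_right_mono) simp
        then show ?thesis using True by (simp add: abs_mult mult_ac)
      qed simp
      then show "AE l in \<mu>. norm (indicator {0..} l *\<^sub>R (e (X n) l *\<^sub>R F l))
          \<le> 2 * norm (indicator {0..} l *\<^sub>R ((l * exp (- (t / 2) * l)) *\<^sub>R F l))" for n by simp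
    qed simp
    then show "(\<lambda>n. (1 / norm (X n - t)) *\<^sub>R (?g (X n) - (?g t + (X n - t) *\<^sub>R ?D))) \<longlonglongrightarrow> 0"
      using X(1) by (subst eq) (auto simp: set_lebesgue_integral_def)
  qed
  then have "(?g has_vector_derivative ?D) (at t within ?S)"
    unfolding has_vector_derivative_def has_derivative_within
    by (rule conjI[OF bounded_linear_scaleR_left])
  then show ?thesis using t by (simp add: at_within_open[of t ?S])
qed

section \<open>Solutions integrated over the spectral parameter, first up to N and then in the
  limit\<close>

section \<open>Superpositions of solutions\<close>

text \<open>The majorant in \<open>dom\<close> covers bounded l only; large l enters later through
  uniform convergence as N grows. The indicator in \<open>meas\<close> discards the irrelevant
  values outside the interval.\<close>

locale sl_solution_family =
  fixes a b :: ereal and p q r :: "real \<Rightarrow> real" and W :: "real \<Rightarrow> real \<Rightarrow> complex" and \<mu> :: "real measure"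
  assumes coeffs: "sl_coefficients a b p q r"
    and sol: "\<And>l. sl_solution a b p q r l (\<lambda>x. W x l)"
    and sigma_finite: "sigma_finite_measure \<mu>" and sets_\<mu>: "sets \<mu> = sets borel"
    and meas: "(\<lambda>(x, l). indicator (einterval a b) x *\<^sub>R W x l) \<in> borel_measurable borel"
    and dom: "\<And>c d N. {c..d} \<subseteq> einterval a b \<Longrightarrow>
      \<exists>g. set_integrable \<mu> {0..N} g \<and> (\<forall>x\<in>{c..d}. \<forall>l\<in>{0..N}. norm (W x l) \<le> g l)"
begin

lemma coeff_cont:
  assumes "{c..d} \<subseteq> einterval a b"
  shows "continuous_on {c..d} p" "continuous_on {c..d} q" "continuous_on {c..d} r"
  using sl_coefficients_continuous[OF coeffs] assms by (auto intro: continuous_on_subset)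

lemma p_pos: "x \<in> einterval a b \<Longrightarrow> p x > 0" and r_pos: "x \<in> einterval a b \<Longrightarrow> r x > 0"
  using coeffs by (auto simp: sl_coefficients_def)

text \<open>The eigenvalue equation as a first-order system for u and \<open>p u'\<close>, in the
  shape that the Volterra representation expects.\<close>

lemma W_derivs:
  assumes "x \<in> einterval a b"
  shows "((\<lambda>x. W x l) has_vector_derivative (1 / p x) *\<^sub>R (p x *\<^sub>R vderiv (\<lambda>x. W x l) x)) (at x)"
    and "((\<lambda>x. p x *\<^sub>R vderiv (\<lambda>x. W x l) x) has_vector_derivative (q x - l * r x) *\<^sub>R W x l) (at x)"
proof -
  let ?u = "\<lambda>x. W x l"
  have d: "?u differentiable (at x)" "(\<lambda>y. p y *\<^sub>R vderiv ?u y) differentiable (at x)"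
    and e: "sl_op p q r ?u x = of_real l * ?u x"
    using sol[of l] assms by (auto simp: sl_solution_def sl_differentiable_on_def)
  show "(?u has_vector_derivative (1 / p x) *\<^sub>R (p x *\<^sub>R vderiv ?u x)) (at x)"
    using differentiable_imp_has_vderiv[OF d(1)] p_pos[OF assms] by simp
  have "r x *\<^sub>R sl_op p q r ?u x = - vderiv (\<lambda>y. p y *\<^sub>R vderiv ?u y) x + q x *\<^sub>R ?u x"
    using r_pos[OF assms] by (simp add: sl_op_def)
  then have "vderiv (\<lambda>y. p y *\<^sub>R vderiv ?u y) x = (q x - l * r x) *\<^sub>R ?u x"
    unfolding e by (simp add: scaleR_conv_of_real algebra_simps)
  then show "((\<lambda>x. p x *\<^sub>R vderiv ?u x) has_vector_derivative (q x - l * r x) *\<^sub>R W x l) (at x)"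
    using differentiable_imp_has_vderiv[OF d(2)] by simp
qed

lemma W_cont: "continuous_on (einterval a b) (\<lambda>x. W x l)"
  by (rule continuous_at_imp_continuous_on) (use W_derivs(1) has_vector_derivative_continuous in blast)

text \<open>The weight is a parameter because the equation links the integral with weight
  \<open>\<phi>\<close> to the one with weight \<open>l * \<phi> l\<close>.\<close>

definition truncated :: "(real \<Rightarrow> real) \<Rightarrow> real \<Rightarrow> real \<Rightarrow> complex" where
  "truncated \<phi> N x = (LINT l:{0..N}|\<mu>. \<phi> l *\<^sub>R W x l)"

context
  fixes c d :: real and \<phi> :: "real \<Rightarrow> real" and N :: real
  assumes cd: "c < d" "{c..d} \<subseteq> einterval a b" and \<phi>: "continuous_on UNIV \<phi>"
begin

lemma W_meas1: "x \<in> {c..d} \<Longrightarrow> (\<lambda>l. W x l) \<in> borel_measurable \<mu>"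
proof -
  assume "x \<in> {c..d}"
  then have "x \<in> einterval a b" using cd by auto
  moreover have "(\<lambda>l. (\<lambda>(x, l). indicator (einterval a b) x *\<^sub>R W x l) (x, l)) \<in> borel_measurable borel"
    by (rule measurable_compose[OF _ meas]) (simp add: borel_prod[symmetric])
  ultimately show ?thesis by (simp cong: measurable_cong_sets add: sets_\<mu> measurable_cong_sets[OF sets_\<mu> refl])
qed

lemma weight_meas: "\<phi> \<in> borel_measurable \<mu>"
  using borel_measurable_continuous_onI[OF \<phi>] measurable_cong_sets[OF sets_\<mu> refl] by blast

lemma Icc_meas: "{0..N} \<in> sets \<mu>"
  by (simp add: sets_\<mu>)

text \<open>A continuous weight is bounded on the compact rectangle, so a multiple of the majorant
  from \<open>dom\<close> works.\<close>

lemma bounded_dom: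
  assumes "continuous_on ({c..d} \<times> {0..N}) (\<lambda>(z, l). k z l :: real)"
  obtains g where "set_integrable \<mu> {0..N} g"
    "\<And>z l. z \<in> {c..d} \<Longrightarrow> l \<in> {0..N} \<Longrightarrow> norm (k z l *\<^sub>R W z l) \<le> g l"
proof -
  obtain g where g: "set_integrable \<mu> {0..N} g" "\<forall>x\<in>{c..d}. \<forall>l\<in>{0..N}. norm (W x l) \<le> g l"
    using dom[OF cd(2)] by blast
  have "bounded ((\<lambda>(z, l). k z l) ` ({c..d} \<times> {0..N}))"
    by (intro compact_imp_bounded compact_continuous_image compact_Times assms compact_Icc)
  then obtain C where C: "\<And>z l. z \<in> {c..d} \<Longrightarrow> l \<in> {0..N} \<Longrightarrow> \<bar>k z l\<bar> \<le> C"
    by (force simp: bounded_iff)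
  show ?thesis
  proof (rule that[of "\<lambda>l. C * g l"])
    show "set_integrable \<mu> {0..N} (\<lambda>l. C * g l)" using g(1) by simp
    fix z l assume zl: "z \<in> {c..d}" "l \<in> {0..N}"
    \<comment> \<open>The sign of C is read off at the given point, since the rectangle is empty for
      negative N.\<close>
    have "norm (W z l) \<le> g l" "0 \<le> C" using C[OF zl] g(2) zl by auto
    then show "norm (k z l *\<^sub>R W z l) \<le> C * g l"
      using C[OF zl] by (auto intro!: mult_mono)
  qed
qed

lemma weight_cont_prod: "continuous_on ({c..d} \<times> {0..N}) (\<lambda>(z, l). \<phi> l)"
  unfolding case_prod_beta
  by (rule continuous_on_compose2[OF \<phi> continuous_on_snd[OF continuous_on_id]]) auto

lemma truncated_integrable:
  assumes "x \<in> {c..d}" shows "set_integrable \<mu> {0..N} (\<lambda>l. \<phi> l *\<^sub>R W x l)"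
proof -
  obtain g where g: "set_integrable \<mu> {0..N} g"
    "\<And>z l. z \<in> {c..d} \<Longrightarrow> l \<in> {0..N} \<Longrightarrow> norm (\<phi> l *\<^sub>R W z l) \<le> g l"
    using bounded_dom[OF weight_cont_prod] by blast
  note [measurable] = W_meas1[OF assms] weight_meas Icc_meas
  show ?thesis
    by (rule set_integrable_bound[OF g(1)])
      (use g(2)[OF assms] in \<open>auto simp: set_borel_measurable_def intro: order_trans[OF _ abs_ge_self]\<close>)
qed

lemma truncated_cont: "continuous_on {c..d} (truncated \<phi> N)"
proof -
  obtain g where g: "set_integrable \<mu> {0..N} g"
    "\<And>z l. z \<in> {c..d} \<Longrightarrow> l \<in> {0..N} \<Longrightarrow> norm (\<phi> l *\<^sub>R W z l) \<le> g l"
    using bounded_dom[OF weight_cont_prod] by blast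
  show ?thesis unfolding truncated_def
  proof (rule continuous_on_set_integral[OF _ _ g])
    show "continuous_on {c..d} (\<lambda>x. \<phi> l *\<^sub>R W x l)" for l
      by (intro continuous_intros continuous_on_subset[OF W_cont cd(2)])
    fix x assume "x \<in> {c..d}"
    note [measurable] = W_meas1[OF this] weight_meas Icc_meas
    show "(\<lambda>l. indicator {0..N} l *\<^sub>R \<phi> l *\<^sub>R W x l) \<in> borel_measurable \<mu>" by measurable
  qed
qed

lemma weight_times_cont: "continuous_on UNIV (\<lambda>l. l * \<phi> l)"
  by (intro continuous_intros \<phi>)

end

text \<open>The Volterra representation of each \<open>W x l\<close> is integrated over l. The slope
  at c is first expressed through the values at c and d, because \<open>dom\<close> bounds W but not
  its derivative.\<close>

lemma truncated_volterra:
  fixes c d N x :: real and \<phi> :: "real \<Rightarrow> real"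
  defines "s \<equiv> scale_fun p c"
    and "H \<equiv> \<lambda>z. q z *\<^sub>R truncated \<phi> N z - r z *\<^sub>R truncated (\<lambda>l. l * \<phi> l) N z"
  assumes cd: "c < d" "{c..d} \<subseteq> einterval a b" and \<phi>: "continuous_on UNIV \<phi>" and x: "x \<in> {c..d}"
  shows "truncated \<phi> N x = truncated \<phi> N c
    + s x *\<^sub>R ((1 / s d) *\<^sub>R (truncated \<phi> N d - truncated \<phi> N c - sl_volterra p c H d))
    + sl_volterra p c H x"
proof -
  note coeff = coeff_cont[OF cd(2)]
  have pos: "y \<in> {c..d} \<Longrightarrow> p y > 0" for y using p_pos cd(2) by auto
  have s_cont: "continuous_on {c..d} s" unfolding s_def by (rule scale_fun_cont[OF coeff(1) pos cd(1)])
  have s_pos: "s d > 0" unfolding s_def by (rule scale_fun_pos[OF coeff(1) pos cd(1)])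
  \<comment> \<open>For \<open>L u = l u\<close> the right-hand side of \<open>(p u')' = h\<close>
    is \<open>(q - l r) u\<close>; \<open>k\<close> is the resulting Volterra kernel including the
    weight.\<close>
  define k where "k y z l = (s y - s z) * \<phi> l * (q z - l * r z)" for y z l
  define K where "K y l = (LINT z:{c..y}|lborel. k y z l *\<^sub>R W z l)" for y l
  have k_cont: "continuous_on ({c..d} \<times> {0..N}) (\<lambda>(z, l). k y z l)" for y
  proof -
    have fst_cont: "continuous_on ({c..d} \<times> {0..N}) (\<lambda>x. f (fst x))" if "continuous_on {c..d} f" for f :: "real \<Rightarrow> real"
      by (rule continuous_on_compose2[OF that continuous_on_fst[OF continuous_on_id]]) auto
    moreover have "continuous_on ({c..d} \<times> {0..N}) (\<lambda>x. \<phi> (snd x))"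
      by (rule continuous_on_compose2[OF \<phi> continuous_on_snd[OF continuous_on_id]]) auto
    ultimately show ?thesis unfolding k_def case_prod_beta
      by (intro continuous_intros fst_cont s_cont coeff)
  qed
  have K_eq: "K y l = \<phi> l *\<^sub>R sl_volterra p c (\<lambda>z. (q z - l * r z) *\<^sub>R W z l) y"
    if y: "y \<in> {c..d}" for y l
  proof -
    have sub: "{c..y} \<subseteq> {c..d}" using y by auto
    have "continuous_on {c..y} (\<lambda>z. k y z l *\<^sub>R W z l)" unfolding k_def
      by (intro continuous_intros continuous_on_subset[OF s_cont sub] continuous_on_subset[OF coeff(2) sub]
          continuous_on_subset[OF coeff(3) sub] continuous_on_subset[OF W_cont order_trans[OF sub cd(2)]])
    then have "K y l = integral {c..y} (\<lambda>z. k y z l *\<^sub>R W z l)"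
      unfolding K_def by (intro set_borel_integral_eq_integral(2) borel_integrable_atLeastAtMost')
    also have "\<dots> = integral {c..y} (\<lambda>z. \<phi> l *\<^sub>R ((s y - s z) *\<^sub>R (q z - l * r z) *\<^sub>R W z l))"
      by (simp add: k_def mult_ac)
    also have "\<dots> = \<phi> l *\<^sub>R integral {c..y} (\<lambda>z. (s y - s z) *\<^sub>R (q z - l * r z) *\<^sub>R W z l)"
      by (rule integral_cmul)
    finally show ?thesis by (simp add: sl_volterra_def s_def)
  qed
  have "W y l = W c l + s y *\<^sub>R (p c *\<^sub>R vderiv (\<lambda>x. W x l) c)
      + sl_volterra p c (\<lambda>z. (q z - l * r z) *\<^sub>R W z l) y" if "y \<in> {c..d}" for y l
    unfolding s_def
    by (rule sl_volterra_of_derivs[OF coeff(1) pos cd(1) W_derivs that]) (use cd(2) in auto)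
  then have rep: "\<phi> l *\<^sub>R W y l = \<phi> l *\<^sub>R W c l + s y *\<^sub>R (\<phi> l *\<^sub>R (p c *\<^sub>R vderiv (\<lambda>x. W x l) c)) + K y l"
    if "y \<in> {c..d}" for y l
    using K_eq[OF that, of l] that by (metis (no_types, lifting) scaleR_add_right scaleR_left_commute)
  \<comment> \<open>The representation at y = d is solved for the slope term, dividing by
    \<open>s d > 0\<close>.\<close>
  have rep': "\<phi> l *\<^sub>R W x l = \<phi> l *\<^sub>R W c l
      + s x *\<^sub>R ((1 / s d) *\<^sub>R (\<phi> l *\<^sub>R W d l - \<phi> l *\<^sub>R W c l - K d l)) + K x l" for l
    using rep[OF x, of l] rep[of d l] s_pos cd(1) by simp
  have K_int: "set_integrable \<mu> {0..N} (K y)" and K_integral: "(LINT l:{0..N}|\<mu>. K y l) = sl_volterra p c H y"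
    if y: "y \<in> {c..d}" for y
  proof -
    have sub: "{c..y} \<subseteq> {c..d}" using y by auto
    obtain g where g: "set_integrable \<mu> {0..N} g"
      "\<And>z l. z \<in> {c..d} \<Longrightarrow> l \<in> {0..N} \<Longrightarrow> norm (k y z l *\<^sub>R W z l) \<le> g l"
      using bounded_dom[OF cd \<phi> k_cont] by blast
    have [measurable]: "\<phi> \<in> borel_measurable borel" by (rule borel_measurable_continuous_onI[OF \<phi>])
    have ind: "(\<lambda>z. indicator {c..y} z *\<^sub>R f z) \<in> borel_measurable borel" if "continuous_on {c..d} f" for f :: "real \<Rightarrow> real"
      by (rule borel_measurable_continuous_on_indicator[OF _ continuous_on_subset[OF that sub]]) simp
    have [measurable]: "(\<lambda>z. indicator {c..y} z *\<^sub>R (s y - s z)) \<in> borel_measurable borel"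
      "(\<lambda>z. indicator {c..y} z *\<^sub>R q z) \<in> borel_measurable borel"
      "(\<lambda>z. indicator {c..y} z *\<^sub>R r z) \<in> borel_measurable borel"
      by (intro ind continuous_intros s_cont) (rule ind[OF coeff(2)] ind[OF coeff(3)])+
    note [measurable] = meas[folded borel_prod]
    \<comment> \<open>The coefficients are controlled only on compact subintervals, so each factor
      is cut off separately to obtain Borel functions. On \<open>{c..y}\<close> all indicators are
      1, elsewhere the product is 0.\<close>
    have "(\<lambda>x. ((indicator {c..y} (fst x) *\<^sub>R (s y - s (fst x))) * \<phi> (snd x) *
        (indicator {c..y} (fst x) *\<^sub>R q (fst x) - snd x * (indicator {c..y} (fst x) *\<^sub>R r (fst x)))) *\<^sub>R
        (\<lambda>(x, l). indicator (einterval a b) x *\<^sub>R W x l) x) \<in> borel_measurable (borel \<Otimes>\<^sub>M borel)"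
      by measurable
    also have "(\<lambda>x. ((indicator {c..y} (fst x) *\<^sub>R (s y - s (fst x))) * \<phi> (snd x) *
        (indicator {c..y} (fst x) *\<^sub>R q (fst x) - snd x * (indicator {c..y} (fst x) *\<^sub>R r (fst x)))) *\<^sub>R
        (\<lambda>(x, l). indicator (einterval a b) x *\<^sub>R W x l) x)
        = (\<lambda>(z, l). indicator {c..y} z *\<^sub>R k y z l *\<^sub>R W z l)"
      using sub cd(2) by (auto simp: k_def indicator_def fun_eq_iff)
    finally have m: "(\<lambda>(z, l). indicator {c..y} z *\<^sub>R k y z l *\<^sub>R W z l) \<in> borel_measurable borel"
      by (simp add: borel_prod)
    have b: "norm (k y z l *\<^sub>R W z l) \<le> g l" if "z \<in> {c..y}" "l \<in> {0..N}" for z l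
      using g(2) that sub by auto
    note swap = set_integral_swap_Icc[OF sigma_finite sets_\<mu> _ g(1) m b]
    show "set_integrable \<mu> {0..N} (K y)" unfolding K_def by (rule swap(1)) auto
    have H_cont: "continuous_on {c..d} H" unfolding H_def
      by (intro continuous_intros coeff truncated_cont[OF cd] \<phi>)
    \<comment> \<open>Splitting \<open>q - l r\<close> sends the factor l into the weight, which
      produces the second truncated integral in \<open>H\<close>.\<close>
    have inner: "(LINT l:{0..N}|\<mu>. k y z l *\<^sub>R W z l) = (s y - s z) *\<^sub>R H z" if "z \<in> {c..y}" for z
    proof -
      have z: "z \<in> {c..d}" using that sub by auto
      have "(LINT l:{0..N}|\<mu>. k y z l *\<^sub>R W z l) = (LINT l:{0..N}|\<mu>. (s y - s z) *\<^sub>R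
          (q z *\<^sub>R (\<phi> l *\<^sub>R W z l) - r z *\<^sub>R ((l * \<phi> l) *\<^sub>R W z l)))"
        by (rule arg_cong[where f = "set_lebesgue_integral \<mu> _"]) (auto simp: k_def fun_eq_iff algebra_simps)
      also have "\<dots> = (s y - s z) *\<^sub>R (LINT l:{0..N}|\<mu>.
          (q z *\<^sub>R (\<phi> l *\<^sub>R W z l) - r z *\<^sub>R ((l * \<phi> l) *\<^sub>R W z l)))"
        by (rule set_integral_scaleR_right)
      also have "(LINT l:{0..N}|\<mu>. (q z *\<^sub>R (\<phi> l *\<^sub>R W z l) - r z *\<^sub>R ((l * \<phi> l) *\<^sub>R W z l))) = H z"
        by (simp add: H_def truncated_def set_integral_diff set_integral_scaleR_right set_integrable_scaleR_right
            truncated_integrable[OF cd \<phi> z] truncated_integrable[OF cd weight_times_cont[OF cd \<phi>] z]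
            del: scaleR_scaleR)
      finally show ?thesis .
    qed
    have "(LINT l:{0..N}|\<mu>. K y l) = (LINT z:{c..y}|lborel. LINT l:{0..N}|\<mu>. k y z l *\<^sub>R W z l)"
      unfolding K_def by (rule swap(2)) auto
    also have "\<dots> = (LINT z:{c..y}|lborel. (s y - s z) *\<^sub>R H z)"
      by (rule set_lebesgue_integral_cong) (auto simp: inner)
    also have "\<dots> = sl_volterra p c H y"
      unfolding sl_volterra_def s_def[symmetric]
      by (intro set_borel_integral_eq_integral(2) borel_integrable_atLeastAtMost' continuous_intros
          continuous_on_subset[OF s_cont sub] continuous_on_subset[OF H_cont sub])
    finally show "(LINT l:{0..N}|\<mu>. K y l) = sl_volterra p c H y" .
  qed
  have cd': "c \<in> {c..d}" "d \<in> {c..d}" using cd(1) by auto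
  note I = truncated_integrable[OF cd \<phi> cd'(1)] truncated_integrable[OF cd \<phi> cd'(2)] K_int[OF cd'(2)] K_int[OF x]
  show ?thesis
    unfolding truncated_def K_integral[OF x, symmetric] K_integral[OF cd'(2), symmetric] rep'
    by (simp add: I set_integral_add set_integral_diff set_integrable_scaleR_right set_integral_scaleR_right)
qed

text \<open>Every term of \<open>truncated_volterra\<close> is stable under uniform convergence on
  compact intervals. The limit therefore satisfies the same formula, from which its derivatives are
  read off.\<close>

lemma limit_solves:
  fixes \<phi> :: "real \<Rightarrow> real" and U U' :: "real \<Rightarrow> complex"
  assumes \<phi>: "continuous_on UNIV \<phi>"
    and U: "\<And>c d. {c..d} \<subseteq> einterval a b \<Longrightarrow> uniform_limit {c..d} (truncated \<phi>) U at_top"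
    and U': "\<And>c d. {c..d} \<subseteq> einterval a b \<Longrightarrow> uniform_limit {c..d} (truncated (\<lambda>l. l * \<phi> l)) U' at_top"
  shows "sl_differentiable_on (einterval a b) p U"
    and "x \<in> einterval a b \<Longrightarrow> sl_op p q r U x = U' x"
proof -
  have main: "U differentiable (at x) \<and> (\<lambda>y. p y *\<^sub>R vderiv U y) differentiable (at x) \<and> sl_op p q r U x = U' x"
    if xI: "x \<in> einterval a b" for x
  proof -
    obtain c d where x: "x \<in> {c<..<d}" and cd: "c < d" "{c..d} \<subseteq> einterval a b"
      using einterval_Icc_nbhd[OF xI] by (metis greaterThanLessThan_iff less_trans)
    note coeff = coeff_cont[OF cd(2)]
    have pos: "y \<in> {c..d} \<Longrightarrow> p y > 0" for y using p_pos cd(2) by auto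
    have cont: "continuous_on {c..d} U" "continuous_on {c..d} U'"
      by (rule uniform_limit_theorem[OF _ U[OF cd(2)]] uniform_limit_theorem[OF _ U'[OF cd(2)]],
          auto intro!: always_eventually truncated_cont[OF cd] continuous_intros \<phi>)+
    define H where "H z = q z *\<^sub>R U z - r z *\<^sub>R U' z" for z
    define HN where "HN N z = q z *\<^sub>R truncated \<phi> N z - r z *\<^sub>R truncated (\<lambda>l. l * \<phi> l) N z" for N z
    have H_cont: "continuous_on {c..d} H"
      unfolding H_def by (intro continuous_intros coeff cont)
    have HN_cont: "continuous_on {c..d} (HN N)" for N
      unfolding HN_def by (intro continuous_intros coeff truncated_cont[OF cd] \<phi>)
    have s_cont: "continuous_on {c..d} (scale_fun p c)" by (rule scale_fun_cont[OF coeff(1) pos cd(1)])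
    \<comment> \<open>Uniform limits may be multiplied by bounded functions; compactness bounds the
      coefficients, the scale function and the limits.\<close>
    have bdd: "bounded (f ` {c..d})" if "continuous_on {c..d} f" for f :: "real \<Rightarrow> 'x :: real_normed_vector"
      using that by (intro compact_imp_bounded compact_continuous_image) auto
    have HN_lim: "uniform_limit {c..d} HN H at_top"
      unfolding HN_def H_def
      by (intro uniform_limit_intros U U' cd bdd coeff cont)
    have lim: "((\<lambda>N. sl_volterra p c (HN N) y) \<longlongrightarrow> sl_volterra p c H y) at_top" if y: "y \<in> {c..d}" for y
    proof -
      have sub: "{c..y} \<subseteq> {c..d}" using y by auto
      have "uniform_limit {c..d} (\<lambda>N z. (scale_fun p c y - scale_fun p c z) *\<^sub>R HN N z)
          (\<lambda>z. (scale_fun p c y - scale_fun p c z) *\<^sub>R H z) at_top"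
        by (intro uniform_limit_intros HN_lim bdd H_cont continuous_intros s_cont)
      then have ul: "uniform_limit {c..y} (\<lambda>N z. (scale_fun p c y - scale_fun p c z) *\<^sub>R HN N z)
          (\<lambda>z. (scale_fun p c y - scale_fun p c z) *\<^sub>R H z) at_top"
        by (rule uniform_limit_on_subset[OF _ sub])
      have cN: "continuous_on {c..y} (\<lambda>z. (scale_fun p c y - scale_fun p c z) *\<^sub>R HN N z)" for N
        by (intro continuous_intros continuous_on_subset[OF s_cont sub] continuous_on_subset[OF HN_cont sub])
      \<comment> \<open>Convergence of the integrals comes with unnamed values, which uniqueness of
        the integral then identifies as Volterra terms.\<close>
      obtain I J where IJ: "\<And>N. ((\<lambda>z. (scale_fun p c y - scale_fun p c z) *\<^sub>R HN N z) has_integral I N) {c..y}"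
        "((\<lambda>z. (scale_fun p c y - scale_fun p c z) *\<^sub>R H z) has_integral J) {c..y}" "(I \<longlongrightarrow> J) at_top"
        using uniform_limit_integral[OF ul cN] by auto
      then have "I = (\<lambda>N. sl_volterra p c (HN N) y)" "J = sl_volterra p c H y"
        unfolding sl_volterra_def by (intro ext integral_unique[symmetric]; blast)+
      then show ?thesis using IJ(3) by simp
    qed
    have pt: "((\<lambda>N. truncated \<phi> N y) \<longlongrightarrow> U y) at_top" if "y \<in> {c..d}" for y
      using tendsto_uniform_limitI[OF U[OF cd(2)] that] .
    have cd': "c \<in> {c..d}" "d \<in> {c..d}" using cd(1) by auto
    \<comment> \<open>The limit of the slope constants of the truncated integrals; it becomes the
      value of \<open>p U'\<close> at c in the formula for \<open>v\<close>.\<close>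
    let ?B = "(1 / scale_fun p c d) *\<^sub>R (U d - U c - sl_volterra p c H d)"
    have rep: "U y = U c + scale_fun p c y *\<^sub>R ?B + sl_volterra p c H y" if y: "y \<in> {c..d}" for y
    proof (rule tendsto_unique[OF _ pt[OF y]])
      have "((\<lambda>N. truncated \<phi> N c + scale_fun p c y *\<^sub>R ((1 / scale_fun p c d) *\<^sub>R
          (truncated \<phi> N d - truncated \<phi> N c - sl_volterra p c (HN N) d)) + sl_volterra p c (HN N) y)
          \<longlongrightarrow> U c + scale_fun p c y *\<^sub>R ?B + sl_volterra p c H y) at_top"
        by (intro tendsto_intros pt lim y cd')
      then show "((\<lambda>N. truncated \<phi> N y) \<longlongrightarrow> U c + scale_fun p c y *\<^sub>R ?B + sl_volterra p c H y) at_top"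
        using truncated_volterra[OF cd \<phi> y] unfolding HN_def by simp
    qed simp
    define v where "v y = ?B + integral {c..y} H" for y
    have D: "(U has_vector_derivative (1 / p y) *\<^sub>R v y) (at y)" "(v has_vector_derivative H y) (at y)"
      if "y \<in> {c<..<d}" for y
      unfolding v_def by (rule sl_volterra_deriv[OF coeff(1) pos cd(1) H_cont rep that]; assumption)+
    have vU: "v y = p y *\<^sub>R vderiv U y" if "y \<in> {c<..<d}" for y
      using vderiv_at[OF D(1)[OF that]] pos[of y] that by simp
    have v': "((\<lambda>y. p y *\<^sub>R vderiv U y) has_vector_derivative H x) (at x)"
      by (rule has_vector_derivative_transform_within_open[OF D(2)[OF x] _ x vU]) auto
    \<comment> \<open>The derivative of \<open>p U'\<close> is \<open>q U - r U'\<close>, where the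
      last prime denotes the second limit; the terms \<open>q U\<close> cancel and division by r
      leaves that limit.\<close>
    have "sl_op p q r U x = U' x"
      unfolding sl_op_def vderiv_at[OF v'] H_def using r_pos[OF xI] by simp
    moreover have "U differentiable (at x)" "(\<lambda>y. p y *\<^sub>R vderiv U y) differentiable (at x)"
      using D(1)[OF x] v' by (auto intro: differentiableI_vector)
    ultimately show ?thesis by blast
  qed
  then show "sl_differentiable_on (einterval a b) p U" "x \<in> einterval a b \<Longrightarrow> sl_op p q r U x = U' x"
    by (auto simp: sl_differentiable_on_def)
qed

end

section \<open>Reduction of the matrix integral to one scalar family of solutions\<close>

section \<open>The generalized Yor integral\<close>

text \<open>The diagonal entries are nonnegative by testing semidefiniteness on the unit vectors.
  This yields sigma-finiteness of the trace measure.\<close>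

lemma matrix_measure_trace_bdd_additive:
  assumes "matrix_measure \<rho>"
  shows "bdd_additive (\<lambda>B. Re (\<Sum>i\<in>UNIV. \<rho> B $ i $ i))"
  unfolding bdd_additive_def
proof (intro conjI ballI allI impI)
  fix B :: "real set" assume B: "B \<in> sets borel" "bounded B"
  then have psd: "0 \<le> Re (\<Sum>i\<in>UNIV. \<Sum>j\<in>UNIV. cnj (v $ i) * \<rho> B $ i $ j * v $ j)" for v :: "complex^2"
    using assms unfolding matrix_measure_def herm_psd_def by blast
  show "0 \<le> Re (\<Sum>i\<in>UNIV. \<rho> B $ i $ i)"
    using psd[of "vector [1, 0]"] psd[of "vector [0, 1]"] by (simp add: sum_2)
next
  fix B :: "nat \<Rightarrow> real set"
  assume "range B \<subseteq> sets borel \<and> disjoint_family B \<and> bounded (\<Union>k. B k)"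
  then have "(\<lambda>k. \<rho> (B k) $ i $ i) sums (\<rho> (\<Union>k. B k) $ i $ i)" for i
    using assms unfolding matrix_measure_def by blast
  then show "(\<lambda>k. Re (\<Sum>i\<in>UNIV. \<rho> (B k) $ i $ i)) sums Re (\<Sum>i\<in>UNIV. \<rho> (\<Union>k. B k) $ i $ i)"
    by (intro sums_Re sums_sum)
qed

text \<open>The integrand does not depend on i, so the sum over i acts on the density alone and
  leaves one scalar function W, integrated against the trace measure.\<close>

lemma mm_integral_weight:
  fixes w :: "2 \<Rightarrow> real \<Rightarrow> real \<Rightarrow> complex" and \<rho> :: "real set \<Rightarrow> complex^2^2"
  defines "W \<equiv> \<lambda>x l. \<Sum>j\<in>UNIV. (\<Sum>i\<in>UNIV. mm_density \<rho> l $ i $ j) * w j x l"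
  shows "mm_integral \<rho> S (\<lambda>i j l. of_real (\<phi> l) * w j x l) = (LINT l:S|mm_trace \<rho>. \<phi> l *\<^sub>R W x l)"
    and "mm_integrable \<rho> S (\<lambda>i j l. of_real (\<phi> l) * w j x l)
      \<longleftrightarrow> set_integrable (mm_trace \<rho>) S (\<lambda>l. \<phi> l *\<^sub>R W x l)"
proof -
  have "(\<Sum>i\<in>UNIV. \<Sum>j\<in>UNIV. of_real (\<phi> l) * w j x l * mm_density \<rho> l $ i $ j) = \<phi> l *\<^sub>R W x l" for l
    unfolding W_def by (simp add: sum_2 scaleR_conv_of_real algebra_simps)
  then show "mm_integral \<rho> S (\<lambda>i j l. of_real (\<phi> l) * w j x l) = (LINT l:S|mm_trace \<rho>. \<phi> l *\<^sub>R W x l)"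
    "mm_integrable \<rho> S (\<lambda>i j l. of_real (\<phi> l) * w j x l)
      \<longleftrightarrow> set_integrable (mm_trace \<rho>) S (\<lambda>l. \<phi> l *\<^sub>R W x l)"
    by (simp_all only: mm_integral_def mm_integrable_def)
qed

text \<open>For fixed l the column sums of the density are constants, so the family consists of
  combinations of the two basis solutions.\<close>

lemma mm_solution_family:
  fixes w :: "2 \<Rightarrow> real \<Rightarrow> real \<Rightarrow> complex"
  assumes coeffs: "sl_coefficients a b p q r"
    and cont: "\<And>j. continuous_on (einterval a b \<times> UNIV) (\<lambda>(x, l). w j x l)"
    and sol: "\<And>j l. sl_solution a b p q r l (\<lambda>x. w j x l)"
    and \<rho>: "matrix_measure \<rho>"
  shows "sl_solution_family a b p q r
    (\<lambda>x l. \<Sum>j\<in>UNIV. (\<Sum>i\<in>UNIV. mm_density \<rho> l $ i $ j) * w j x l) (mm_trace \<rho>)"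
proof
  let ?I = "einterval a b"
  define m where "m j l = (\<Sum>i\<in>UNIV. mm_density \<rho> l $ i $ j)" for j l
  have dens: "is_mm_density \<rho> (mm_density \<rho>)" by (rule mm_density_exists[OF \<rho>])
  have m_meas: "m j \<in> borel_measurable borel" for j
    using dens unfolding m_def is_mm_density_def by (intro borel_measurable_sum) blast
  have m_int: "set_integrable (mm_trace \<rho>) {0..N} (m j)" for j N
  proof -
    have "set_integrable (mm_trace \<rho>) {0..N} (\<lambda>l. mm_density \<rho> l $ i $ j)" for i
      using dens unfolding is_mm_density_def by (meson atLeastAtMost_borel bounded_closed_interval)
    then show ?thesis unfolding m_def sum_2 by (intro set_integral_add(1))
  qed
  note m_fold = m_def[symmetric]
  show "sl_coefficients a b p q r" by fact
  show "sl_solution a b p q r l (\<lambda>x. \<Sum>j\<in>UNIV. (\<Sum>i\<in>UNIV. mm_density \<rho> l $ i $ j) * w j x l)" for l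
    unfolding m_fold sum_2[of "\<lambda>j. m j l * _ j"] by (rule sl_solution_linear[OF sol sol])
  show "\<exists>A. countable A \<and> A \<subseteq> sets (mm_trace \<rho>) \<and> \<Union> A = space (mm_trace \<rho>) \<and>
      (\<forall>a\<in>A. emeasure (mm_trace \<rho>) a \<noteq> \<infinity>)"
    using sigma_finite_bdd_measure[OF matrix_measure_trace_bdd_additive[OF \<rho>]]
    unfolding mm_trace_eq sigma_finite_measure_def .
  show "sets (mm_trace \<rho>) = sets borel" by (simp add: mm_trace_eq)
  show "(\<lambda>(x, l). indicator ?I x *\<^sub>R (\<Sum>j\<in>UNIV. (\<Sum>i\<in>UNIV. mm_density \<rho> l $ i $ j) * w j x l)) \<in> borel_measurable borel"
  proof -
    \<comment> \<open>Joint continuity on the open strip makes \<open>w j\<close> times the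
      indicator of the strip Borel.\<close>
    have w_meas: "(\<lambda>x. indicator (?I \<times> UNIV) x *\<^sub>R (\<lambda>(x, l). w j x l) x) \<in> borel_measurable borel" for j
      by (rule borel_measurable_continuous_on_indicator[OF _ cont]) (intro borel_open open_Times open_einterval open_UNIV)
    have "(\<lambda>x. m j (snd x)) \<in> borel_measurable borel" for j
      by (rule measurable_compose[OF _ m_meas]) (intro borel_measurable_continuous_onI continuous_intros)
    then have "(\<lambda>x. \<Sum>j\<in>UNIV. m j (snd x) * (indicator (?I \<times> UNIV) x *\<^sub>R (\<lambda>(x, l). w j x l) x)) \<in> borel_measurable borel"
      by (intro borel_measurable_sum borel_measurable_times w_meas)
    also have "(\<lambda>x. \<Sum>j\<in>UNIV. m j (snd x) * (indicator (?I \<times> UNIV) x *\<^sub>R (\<lambda>(x, l). w j x l) x))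
        = (\<lambda>(x, l). indicator ?I x *\<^sub>R (\<Sum>j\<in>UNIV. m j l * w j x l))"
      by (auto simp: fun_eq_iff indicator_def)
    finally show ?thesis unfolding m_fold .
  qed
  fix c d N :: real assume cd: "{c..d} \<subseteq> ?I"
  have "bounded ((\<lambda>(x, l). w j x l) ` ({c..d} \<times> {0..N}))" for j
    by (intro compact_imp_bounded compact_continuous_image compact_Times compact_Icc
        continuous_on_subset[OF cont]) (use cd in auto)
  then have "\<exists>C. \<forall>x\<in>{c..d}. \<forall>l\<in>{0..N}. norm (w j x l) \<le> C" for j
    by (force simp: bounded_iff)
  then obtain C where C: "\<And>j x l. x \<in> {c..d} \<Longrightarrow> l \<in> {0..N} \<Longrightarrow> norm (w j x l) \<le> C j" by metis
  \<comment> \<open>The majorant for \<open>dom\<close>: the density is integrable over bounded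
    sets, and \<open>C j\<close> bounds \<open>w j\<close> on the compact rectangle.\<close>
  have "set_integrable (mm_trace \<rho>) {0..N} (\<lambda>l. norm (m 1 l) * C 1 + norm (m 2 l) * C 2)"
    by (intro set_integral_add(1) set_integrable_mult_left set_integrable_norm m_int)
  moreover have "norm (\<Sum>j\<in>UNIV. m j l * w j x l) \<le> norm (m 1 l) * C 1 + norm (m 2 l) * C 2"
    if "x \<in> {c..d}" "l \<in> {0..N}" for x l
  proof -
    have "norm (m j l * w j x l) \<le> norm (m j l) * C j" for j
      using C[OF that] by (simp add: norm_mult mult_left_mono)
    then show ?thesis unfolding sum_2 by (rule norm_triangle_mono; blast)
  qed
  ultimately show "\<exists>g. set_integrable (mm_trace \<rho>) {0..N} g \<and> (\<forall>x\<in>{c..d}. \<forall>l\<in>{0..N}.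
      norm (\<Sum>j\<in>UNIV. (\<Sum>i\<in>UNIV. mm_density \<rho> l $ i $ j) * w j x l) \<le> g l)"
    unfolding m_fold by blast
qed

section \<open>The integrals with weights \<open>(- l) ^ k * exp (- t * l)\<close> and the iteration
  in k\<close>

theorem lemma3p13:
  fixes a b :: ereal and p q r :: "real \<Rightarrow> real" and c \<alpha>\<^sub>a \<alpha>\<^sub>b :: real
    and w :: "2 \<Rightarrow> real \<Rightarrow> real \<Rightarrow> complex" and \<rho> :: "real set \<Rightarrow> complex^2^2" and n :: nat
  assumes coeffs: "sl_coefficients a b p q r"
    and c: "c \<in> einterval a b"
    and alpha: "\<alpha>\<^sub>a \<in> {0..1}" "\<alpha>\<^sub>b \<in> {0..1}"
    and self_adjoint: "self_adjoint_on (weighted_measure a b r)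
          (sl_domain a b p q r c \<alpha>\<^sub>a \<alpha>\<^sub>b) (sl_op p q r)"
    and w_cont: "\<And>i. continuous_on (einterval a b \<times> UNIV) (\<lambda>(x, l). w i x l)"
    and w_basis: "\<And>l. sl_solution_basis a b p q r l (\<lambda>x. w 1 x l) (\<lambda>x. w 2 x l)"
    and assoc: "associated_matrix_measure a b r w \<rho>"
    and exp_L2: "\<And>t. t > 0 \<Longrightarrow> (\<lambda>l. \<chi> i. of_real (exp (- t * l))) \<in> mm_L2 \<rho>"
    and w_smooth: "\<And>k j l x. x \<in> einterval a b \<Longrightarrow>
          ((vderiv ^^ k) (\<lambda>y. w j y l)) differentiable (at x)"
    and conv_t: "\<And>k. converges_abs_unif a b \<rho>
          (\<lambda>t x i j l. of_real (l ^ k * exp (- t * l)) * w j x l)"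
    and conv_x: "\<And>k. converges_abs_unif a b \<rho>
          (\<lambda>t x i j l. of_real (exp (- t * l)) * (vderiv ^^ k) (\<lambda>y. w j y l) x)"
  shows "solves_sl_pde a b p q r n (yor_integral \<rho> w)"
proof -
  let ?I = "einterval a b"
  define W where "W x l = (\<Sum>j\<in>UNIV. (\<Sum>i\<in>UNIV. mm_density \<rho> l $ i $ j) * w j x l)" for x l
  define \<mu> where "\<mu> = mm_trace \<rho>"
  \<comment> \<open>The sign is part of the weight, so that \<open>d/dt\<close> and
    \<open>-L\<close> both raise k by exactly one.\<close>
  define \<phi> where "\<phi> k t l = (- l) ^ k * exp (- t * l)" for k :: nat and t l :: real
  define \<Psi> where "\<Psi> k t x = (LINT l:{0..}|\<mu>. \<phi> k t l *\<^sub>R W x l)" for k t x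
  have \<rho>: "matrix_measure \<rho>" using assoc by (simp add: associated_matrix_measure_def)
  have sol: "sl_solution a b p q r l (\<lambda>x. w j x l)" for j l
    using w_basis[of l] exhaust_2[of j] by (auto simp: sl_solution_basis_def)
  interpret sl_solution_family a b p q r W \<mu>
    unfolding W_def \<mu>_def by (rule mm_solution_family[OF coeffs w_cont sol \<rho>])
  note weight = mm_integral_weight[where \<rho> = \<rho> and w = w, folded W_def \<mu>_def]
  \<comment> \<open>The convergence hypothesis is stated with \<open>l ^ k\<close>; the weights
    differ from it by the constant \<open>(-1) ^ k\<close>.\<close>
  have sgn: "\<phi> k t l *\<^sub>R z = (-1) ^ k *\<^sub>R ((l ^ k * exp (- t * l)) *\<^sub>R z)" for k t l and z :: complex
    unfolding \<phi>_def by (subst power_minus) simp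
  have int: "set_integrable \<mu> {0..} (\<lambda>l. \<phi> k t l *\<^sub>R W x l)" if "t > 0" "x \<in> ?I" for k t x
  proof -
    \<comment> \<open>A one-point interval turns the hypothesis on compact intervals into
      integrability at x.\<close>
    have x: "{x..x} \<subseteq> ?I" using that by simp
    have "mm_integrable \<rho> {0..} (\<lambda>i j l. of_real (l ^ k * exp (- t * l)) * w j x l)"
      using conv_t[of k, unfolded converges_abs_unif_def, rule_format, OF that(1) x] by simp
    then show ?thesis unfolding weight sgn by (rule set_integrable_scaleR_right)
  qed
  have lim: "uniform_limit {c..d} (truncated (\<phi> k t)) (\<Psi> k t) at_top"
    if "t > 0" "{c..d} \<subseteq> ?I" for k t c d
  proof -
    have "uniform_limit ({t..} \<times> {c..d})
        (\<lambda>N (s, x). LINT l:{0..N}|\<mu>. (l ^ k * exp (- s * l)) *\<^sub>R W x l)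
        (\<lambda>(s, x). LINT l:{0..}|\<mu>. (l ^ k * exp (- s * l)) *\<^sub>R W x l) at_top"
      using conv_t[of k] that unfolding converges_abs_unif_def weight by blast
    \<comment> \<open>Restriction of the joint uniform limit to the slice s = t.\<close>
    then have "uniform_limit {c..d}
        (\<lambda>N x. LINT l:{0..N}|\<mu>. (l ^ k * exp (- t * l)) *\<^sub>R W x l)
        (\<lambda>x. LINT l:{0..}|\<mu>. (l ^ k * exp (- t * l)) *\<^sub>R W x l) at_top"
      using uniform_limit_compose'[where h = "Pair t" and B = "{c..d}"] by fastforce
    then have "uniform_limit {c..d}
        (\<lambda>N x. (-1) ^ k *\<^sub>R (LINT l:{0..N}|\<mu>. (l ^ k * exp (- t * l)) *\<^sub>R W x l))
        (\<lambda>x. (-1) ^ k *\<^sub>R (LINT l:{0..}|\<mu>. (l ^ k * exp (- t * l)) *\<^sub>R W x l)) at_top"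
      by (rule bounded_linear.uniform_limit[OF bounded_linear_scaleR_right])
    then show ?thesis
      unfolding truncated_def \<Psi>_def sgn set_integral_scaleR_right .
  qed
  have \<phi>_cont: "continuous_on UNIV (\<phi> k t)" for k t
    unfolding \<phi>_def by (intro continuous_intros)
  \<comment> \<open>This identifies the limit with weight \<open>l * \<phi> k t l\<close> as
    \<open>- \<Psi> (Suc k) t\<close>, so \<open>limit_solves\<close> gives the equation for
    \<open>\<Psi> k t\<close>.\<close>
  have \<phi>_Suc: "l * \<phi> k t l = - \<phi> (Suc k) t l" for k t l by (simp add: \<phi>_def)
  have x_diff: "sl_differentiable_on ?I p (\<Psi> k t)"
    and x_op: "x \<in> ?I \<Longrightarrow> - sl_op p q r (\<Psi> k t) x = \<Psi> (Suc k) t x" if t: "t > 0" for k t x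
  proof -
    have lim': "uniform_limit {c..d} (truncated (\<lambda>l. l * \<phi> k t l)) (\<lambda>x. - \<Psi> (Suc k) t x) at_top"
      if "{c..d} \<subseteq> ?I" for c d
    proof -
      have "truncated (\<lambda>l. l * \<phi> k t l) = (\<lambda>N x. - truncated (\<phi> (Suc k) t) N x)"
        unfolding truncated_def \<phi>_Suc by (simp add: set_lebesgue_integral_def fun_eq_iff)
      then show ?thesis using uniform_limit_uminus[OF lim[OF t that]] by simp
    qed
    show "sl_differentiable_on ?I p (\<Psi> k t)" by (rule limit_solves(1)[OF \<phi>_cont lim[OF t] lim'])
    show "- sl_op p q r (\<Psi> k t) x = \<Psi> (Suc k) t x" if "x \<in> ?I"
      using limit_solves(2)[OF \<phi>_cont lim[OF t] lim' that] by simp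
  qed
  have t_deriv: "((\<lambda>s. \<Psi> k s x) has_vector_derivative \<Psi> (Suc k) t x) (at t)"
    if "t > 0" "x \<in> ?I" for k t x
  proof -
    \<comment> \<open>The factor \<open>(- l) ^ k\<close> is moved to W, which leaves the Laplace
      form with \<open>F l = (- l) ^ k * W x l\<close>.\<close>
    have 0: "\<phi> k s l *\<^sub>R z = exp (- s * l) *\<^sub>R ((- l) ^ k *\<^sub>R z)"
      and 1: "\<phi> (Suc k) s l *\<^sub>R z = - ((l * exp (- s * l)) *\<^sub>R ((- l) ^ k *\<^sub>R z))" for s l and z :: complex
      by (simp_all add: \<phi>_def mult_ac)
    have i0: "set_integrable \<mu> {0..} (\<lambda>l. exp (- s * l) *\<^sub>R ((- l) ^ k *\<^sub>R W x l))" if "s > 0" for s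
      using int[OF that \<open>x \<in> ?I\<close>, of k] unfolding 0 .
    have i1: "set_integrable \<mu> {0..} (\<lambda>l. (l * exp (- s * l)) *\<^sub>R ((- l) ^ k *\<^sub>R W x l))" if "s > 0" for s
      using int[OF that \<open>x \<in> ?I\<close>, of "Suc k"] unfolding 1 by (simp add: set_integrable_def)
    show ?thesis
      using laplace_has_vector_derivative[OF that(1) i0 i1] unfolding \<Psi>_def 0 1
      by (simp add: set_lebesgue_integral_def)
  qed
  have yor: "yor_integral \<rho> w = \<Psi> 0"
    by (simp add: fun_eq_iff yor_integral_def weight \<Psi>_def \<phi>_def)
  have t_iter: "(vderiv ^^ k) (\<lambda>s. \<Psi> 0 s x) t = \<Psi> k t x" if "x \<in> ?I" "t > 0" for k t x
    using that(2)
  proof (induction k arbitrary: t)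
    case (Suc k)
    \<comment> \<open>The induction hypothesis holds only for positive times, an open set, which is
      enough to compare derivatives at t.\<close>
    have "vderiv ((vderiv ^^ k) (\<lambda>s. \<Psi> 0 s x)) t = vderiv (\<lambda>s. \<Psi> k s x) t"
      by (rule vderiv_cong_open[of "{0<..}"]) (use Suc in auto)
    then show ?case using vderiv_at[OF t_deriv[OF Suc.prems that(1)]] by simp
  qed simp
  let ?L = "\<lambda>v y. - sl_op p q r v y"
  have x_iter: "(?L ^^ k) (\<Psi> 0 t) x = \<Psi> k t x" if "t > 0" "x \<in> ?I" for k t x
    using that(2)
  proof (induction k arbitrary: x)
    case (Suc k)
    \<comment> \<open>Likewise in x: agreement on the open interval suffices by locality.\<close>
    have "sl_op p q r ((?L ^^ k) (\<Psi> 0 t)) x = sl_op p q r (\<Psi> k t) x"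
      by (rule sl_op_cong_open[OF open_einterval _ Suc.prems]) (rule Suc.IH)
    then show ?case using x_op[OF that(1) Suc.prems] by simp
  qed simp
  show ?thesis
    unfolding solves_sl_pde_def yor
  proof (intro conjI allI impI ballI)
    fix t x :: real and k assume tx: "0 < t" "x \<in> ?I" and "k < n"
    have "(\<lambda>s. \<Psi> k s x) differentiable (at t)"
      using t_deriv[OF tx] by (rule differentiableI_vector)
    then show "(vderiv ^^ k) (\<lambda>s. \<Psi> 0 s x) differentiable (at t)"
      by (rule differentiable_cong_open[rotated 3, of _ _ "{0<..}"]) (use tx t_iter in auto)
  next
    fix t :: real and k assume "0 < t"
    then show "sl_differentiable_on ?I p ((?L ^^ k) (\<Psi> 0 t))"
      using x_iter by (intro sl_differentiable_on_cong_open[OF open_einterval _ x_diff[of t k]]) simp_all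
  next
    fix t x :: real assume "0 < t" "x \<in> ?I"
    then show "(vderiv ^^ n) (\<lambda>s. \<Psi> 0 s x) t = (?L ^^ n) (\<Psi> 0 t) x"
      by (simp add: t_iter x_iter)
  qed
qed

end
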